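(* Let $d>1000$. Consider reality testing for pure states $\ket{\psi}\in\mathbb{C}^d$, where the input is given via a state preparation unitary $U\in\mathbb{C}^{2d^2\times 2d^2}=(\mathbb{C}^{2d\times 2d})_{\mathsf A}\otimes(\mathbb{C}^{d\times d})_{\mathsf B}$ of $\ket\psi\bra\psi$. Then: (i) any quantum algorithm that, given only (black-box) query access to $U$ and $U^\dagger$, solves reality testing for every pure state $\ket\psi$ and every such state preparation unitary $U$ of $\ket\psi\bra\psi$ must make $\Omega(d^{1/4})$ queries; (ii) reality testing can be solved with a constant number of queries (two queries to $U$ and two to $U^*$ suffice) if query access to $U$ and its entrywise complex conjugate $U^*$ is given.
   Context: For a pure state $\ket\psi\in\mathbb{C}^d$ with amplitudes $\psi_i$, define $\mathrm{real}(\ket\psi)=|\langle\psi^*|\psi\rangle|^2=\big|\sum_{i=1}^d\psi_i^2\big|^2$, where $\ket{\psi^*}$ is the entrywise complex conjugate. Reality testing: given access to $\ket\psi$, decide with success probability at least $2/3$ whether $\mathrm{real}(\ket\psi)=1$ or $\mathrm{real}(\ket\psi)<1/10$ (promise: one of the two holds). A unitary $U\in(\mathbb{C}^{\hat d\times\hat d})_{\mathsf A}\otimes(\mathbb{C}^{d\times d})_{\mathsf B}$ is a state preparation unitary for a density matrix $\rho$ on $\mathbb{C}^d$ if $\mathrm{tr}_{\mathsf A}(U\ket0\bra0_{\mathsf{AB}}U^\dagger)=\rho_{\mathsf B}$. *)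

theory Defs
  imports Complex_Main "Jordan_Normal_Form.Matrix"
begin

text \<open>Matrices over the complex numbers, represented with Jordan_Normal_Form matrices
  (dimensions as natural numbers). Tensor index convention: for A (dim a) tensor B (dim b),
  the basis vector |x>|y> has index x*b + y.\<close>

definition adj :: "complex mat \<Rightarrow> complex mat" where
  "adj A = mat (dim_col A) (dim_row A) (\<lambda>(i,j). cnj (A $$ (j,i)))"

definition conj_mat :: "complex mat \<Rightarrow> complex mat" where
  "conj_mat A = map_mat cnj A"

definition is_unitary :: "nat \<Rightarrow> complex mat \<Rightarrow> bool" where
  "is_unitary n A \<longleftrightarrow> A \<in> carrier_mat n n \<and> A * adj A = 1\<^sub>m n \<and> adj A * A = 1\<^sub>m n"

definition kron :: "complex mat \<Rightarrow> complex mat \<Rightarrow> complex mat" where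
  "kron A B = mat (dim_row A * dim_row B) (dim_col A * dim_col B)
     (\<lambda>(i,j). A $$ (i div dim_row B, j div dim_col B) * B $$ (i mod dim_row B, j mod dim_col B))"

definition outer :: "complex vec \<Rightarrow> complex mat" where
  "outer v = mat (dim_vec v) (dim_vec v) (\<lambda>(i,j). v $ i * cnj (v $ j))"

definition ptrace_A :: "nat \<Rightarrow> nat \<Rightarrow> complex mat \<Rightarrow> complex mat" where
  "ptrace_A a b \<rho> = mat b b (\<lambda>(i,j). \<Sum>k<a. \<rho> $$ (k*b + i, k*b + j))"

definition is_pure_state :: "nat \<Rightarrow> complex vec \<Rightarrow> bool" where
  "is_pure_state d \<psi> \<longleftrightarrow> \<psi> \<in> carrier_vec d \<and> (\<Sum>i<d. (cmod (\<psi> $ i))\<^sup>2) = 1"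

definition realness :: "nat \<Rightarrow> complex vec \<Rightarrow> real" where
  "realness d \<psi> = (cmod (\<Sum>i<d. (\<psi> $ i)\<^sup>2))\<^sup>2"

definition state_prep :: "nat \<Rightarrow> complex vec \<Rightarrow> complex mat \<Rightarrow> bool" where
  "state_prep d \<psi> U \<longleftrightarrow> is_unitary (2*d*d) U \<and>
     ptrace_A (2*d) d (outer (U *\<^sub>v unit_vec (2*d*d) 0)) = outer \<psi>"

datatype query = QU | QUdag | QUconj

definition query_op :: "query \<Rightarrow> complex mat \<Rightarrow> nat \<Rightarrow> complex mat" where
  "query_op q U W = kron (case q of QU \<Rightarrow> U | QUdag \<Rightarrow> adj U | QUconj \<Rightarrow> conj_mat U) (1\<^sub>m W)"

definition final_state :: "nat \<Rightarrow> nat \<Rightarrow> complex mat \<Rightarrow> (query \<times> complex mat) list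
    \<Rightarrow> complex mat \<Rightarrow> complex vec" where
  "final_state d W V0 steps U =
     foldl (\<lambda>v (q, V). V *\<^sub>v (query_op q U W *\<^sub>v v)) (V0 *\<^sub>v unit_vec (2*d*d*W) 0) steps"

definition accept_prob :: "nat \<Rightarrow> nat set \<Rightarrow> complex vec \<Rightarrow> real" where
  "accept_prob N Acc v = (\<Sum>i\<in>{i. i < N \<and> i \<in> Acc}. (cmod (v $ i))\<^sup>2)"

definition is_alg :: "nat \<Rightarrow> nat \<Rightarrow> complex mat \<Rightarrow> (query \<times> complex mat) list \<Rightarrow> bool" where
  "is_alg d W V0 steps \<longleftrightarrow> W > 0 \<and> is_unitary (2*d*d*W) V0 \<and>
     (\<forall>s \<in> set steps. is_unitary (2*d*d*W) (snd s))"

definition solves_reality :: "nat \<Rightarrow> query set \<Rightarrow> nat \<Rightarrow> complex mat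
    \<Rightarrow> (query \<times> complex mat) list \<Rightarrow> nat set \<Rightarrow> bool" where
  "solves_reality d Q W V0 steps Acc \<longleftrightarrow> is_alg d W V0 steps \<and> fst ` set steps \<subseteq> Q \<and>
     (\<forall>\<psi> U. is_pure_state d \<psi> \<and> state_prep d \<psi> U \<longrightarrow>
        (realness d \<psi> = 1 \<longrightarrow> accept_prob (2*d*d*W) Acc (final_state d W V0 steps U) \<ge> 2/3) \<and>
        (realness d \<psi> < 1/10 \<longrightarrow> accept_prob (2*d*d*W) Acc (final_state d W V0 steps U) \<le> 1/3))"

end

theory Submission
  imports Defs "Jordan_Normal_Form.Determinant" "HOL-Analysis.Convex"
begin

text \<open>
  Lower bound. For a set \<open>X\<close> of indices and unimodular \<open>\<beta>\<close> consider the state with amplitudes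
  \<open>\<psi>\<^sub>j = \<plusminus>\<beta>\<^sub>j / sqrt d\<close>, the sign being negative iff \<open>j \<in> X\<close>, and the reflection that
  exchanges \<open>|0>|0>\<close> with \<open>|1>|\<psi>>\<close>. It is a self-adjoint state preparation unitary, so adjoint
  queries are worthless. For \<open>\<beta> = 1\<close> the realness is 1; for \<open>\<beta>\<^sub>j = exp (\<i>\<pi>j/d)\<close> it is 0, as the
  \<open>\<beta>\<^sub>j\<^sup>2\<close> are the \<open>d\<close>-th roots of unity. Expand the state of the algorithm, as a function of \<open>X\<close>, in
  the characters \<open>(-1)^|S \<inter> X|\<close>; then a query moves the label \<open>S\<close> by at most two elements.
  Multiplying the coefficient at \<open>S\<close> by \<open>\<Prod>j\<in>S. \<beta>\<^sub>j\<close> changes no mean acceptance probability and would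
  turn the run for \<open>\<beta> = 1\<close> into the one for \<open>\<beta>\<close> if every \<open>\<beta>\<^sub>j\<close> came with an element \<open>j\<close> entering \<open>S\<close>
  and every conjugate with one leaving it. The wrong transitions act on labels of size \<open>O(t)\<close> with
  norm \<open>O(sqrt (t/d))\<close>, so after \<open>t\<close> queries the two runs are within \<open>O(sqrt (t^3/d))\<close>. This forces
  \<open>t = \<Omega>(d^(1/3))\<close>, more than is claimed.

  Upper bound. The swap test on \<open>\<psi>\<close> and its conjugate accepts with probability \<open>(1 + r)/2\<close>, where
  \<open>r\<close> is the realness; run it twice and accept iff both runs do.
\<close>

section \<open>Unitary matrices and tensor products\<close>

lemma sum_mult_index:
  fixes f :: "nat \<Rightarrow> 'a::comm_monoid_add"
  shows "(\<Sum>i<m*k. f i) = (\<Sum>a<m. \<Sum>b<k. f (a*k+b))"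
proof -
  have "(\<Sum>i<m*k. f i) = (\<Sum>a<m. sum f {a*k..<a*k+k})"
    by (rule sum.nat_group[symmetric])
  also have "\<dots> = (\<Sum>a<m. \<Sum>b<k. f (a*k+b))"
  proof (rule sum.cong[OF refl])
    show "sum f {a*k..<a*k+k} = (\<Sum>b<k. f (a*k+b))" for a
      using sum.shift_bounds_nat_ivl[of f 0 "a*k" k] by (simp add: add.commute atLeast0LessThan)
  qed
  finally show ?thesis .
qed

lemma pair_index_less:
  fixes a b m k :: nat
  assumes "a < m" "b < k"
  shows "a*k + b < m*k"
proof -
  have "a*k + b < Suc a * k" using assms by simp
  also have "\<dots> \<le> m*k" using assms by (intro mult_right_mono) auto
  finally show ?thesis .
qed

lemma pair_index_cases:
  fixes i n m :: nat
  assumes "i < n * m"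
  obtains a b where "a < n" "b < m" "i = a*m+b"
proof
  have "m > 0" using assms by (cases m) auto
  then show "i mod m < m" by simp
  show "i div m < n" using assms by (simp add: less_mult_imp_div_less)
  show "i = (i div m) * m + i mod m" by simp
qed

lemma adj_carrier: "A \<in> carrier_mat n m \<Longrightarrow> adj A \<in> carrier_mat m n"
  by (auto simp: adj_def)

lemma conj_mat_carrier: "A \<in> carrier_mat n m \<Longrightarrow> conj_mat A \<in> carrier_mat n m"
  by (simp add: conj_mat_def)

lemma outer_carrier: "v \<in> carrier_vec n \<Longrightarrow> outer v \<in> carrier_mat n n"
  by (auto simp: outer_def)

lemma index_mult_mat_sum:
  assumes "A \<in> carrier_mat n m" "B \<in> carrier_mat m l" "i < n" "j < l"
  shows "(A * B) $$ (i,j) = (\<Sum>k<m. A $$ (i,k) * B $$ (k,j))"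
  using assms by (auto simp: scalar_prod_def atLeast0LessThan intro!: sum.cong)

lemma index_mult_mat_vec_sum:
  assumes "A \<in> carrier_mat n m" "v \<in> carrier_vec m" "i < n"
  shows "(A *\<^sub>v v) $ i = (\<Sum>k<m. A $$ (i,k) * v $ k)"
  using assms by (auto simp: scalar_prod_def atLeast0LessThan intro!: sum.cong)

lemma cscalar_prod_sum:
  fixes v w :: "complex vec"
  assumes "v \<in> carrier_vec n" "w \<in> carrier_vec n"
  shows "v \<bullet>c w = (\<Sum>i<n. v $ i * cnj (w $ i))"
  using assms by (auto simp: scalar_prod_def atLeast0LessThan intro!: sum.cong)

lemma cscalar_prod_diff:
  fixes x y z :: "complex vec"
  assumes x: "x \<in> carrier_vec n" and y: "y \<in> carrier_vec n" and z: "z \<in> carrier_vec n"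
  shows "(x - y) \<bullet>c z = x \<bullet>c z - y \<bullet>c z" and "z \<bullet>c (x - y) = z \<bullet>c x - z \<bullet>c y"
proof -
  have diff: "x - y \<in> carrier_vec n" using x y by simp
  show "(x - y) \<bullet>c z = x \<bullet>c z - y \<bullet>c z"
    unfolding cscalar_prod_sum[OF diff z] cscalar_prod_sum[OF x z] cscalar_prod_sum[OF y z]
    using x y by (simp add: left_diff_distrib sum_subtractf)
  show "z \<bullet>c (x - y) = z \<bullet>c x - z \<bullet>c y"
    unfolding cscalar_prod_sum[OF z diff] cscalar_prod_sum[OF z x] cscalar_prod_sum[OF z y]
    using x y by (simp add: right_diff_distrib sum_subtractf)
qed

lemma is_unitary_carrier: "is_unitary n A \<Longrightarrow> A \<in> carrier_mat n n"
  by (simp add: is_unitary_def)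

lemma is_unitaryI:
  assumes "A \<in> carrier_mat n n" "A * adj A = 1\<^sub>m n"
  shows "is_unitary n A"
  using mat_mult_left_right_inverse[OF assms(1) adj_carrier[OF assms(1)] assms(2)] assms
  by (simp add: is_unitary_def)

lemma is_unitary_rowsI:
  assumes A: "A \<in> carrier_mat n n"
    and rows: "\<And>i j. i < n \<Longrightarrow> j < n \<Longrightarrow>
      (\<Sum>k<n. A $$ (i,k) * cnj (A $$ (j,k))) = (if i = j then 1 else 0)"
  shows "is_unitary n A"
proof (rule is_unitaryI[OF A], rule eq_matI)
  fix i j assume "i < dim_row (1\<^sub>m n :: complex mat)" "j < dim_col (1\<^sub>m n :: complex mat)"
  then have ij: "i < n" "j < n" by auto
  have "(A * adj A) $$ (i,j) = (\<Sum>k<n. A $$ (i,k) * cnj (A $$ (j,k)))"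
    using index_mult_mat_sum[OF A adj_carrier[OF A] ij] A ij by (simp add: adj_def)
  then show "(A * adj A) $$ (i,j) = 1\<^sub>m n $$ (i,j)" using rows[OF ij] ij by simp
qed (use A in \<open>auto simp: adj_def\<close>)

lemma is_unitary_one: "is_unitary n (1\<^sub>m n)"
proof -
  have "adj (1\<^sub>m n) = 1\<^sub>m n" by (intro eq_matI) (auto simp: adj_def)
  then show ?thesis by (simp add: is_unitary_def)
qed

lemma sum_square_orthogonal_columns:
  fixes a :: "'i \<Rightarrow> 'j \<Rightarrow> complex" and C :: real
  assumes "finite J"
    and orthogonal: "\<And>k j. k \<in> J \<Longrightarrow> j \<in> J \<Longrightarrow>
      (\<Sum>i\<in>I. cnj (a i k) * a i j) = (if k = j then complex_of_real C else 0)"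
  shows "(\<Sum>i\<in>I. (cmod (\<Sum>j\<in>J. a i j * f j))\<^sup>2) = C * (\<Sum>j\<in>J. (cmod (f j))\<^sup>2)"
proof -
  have "complex_of_real (\<Sum>i\<in>I. (cmod (\<Sum>j\<in>J. a i j * f j))\<^sup>2)
      = (\<Sum>i\<in>I. (\<Sum>k\<in>J. cnj (a i k * f k)) * (\<Sum>j\<in>J. a i j * f j))"
    by (simp add: complex_norm_square mult.commute del: of_real_power)
  also have "\<dots> = (\<Sum>i\<in>I. \<Sum>k\<in>J. \<Sum>j\<in>J. (cnj (f k) * f j) * (cnj (a i k) * a i j))"
    unfolding sum_product by (intro sum.cong refl) (simp add: mult_ac)
  also have "\<dots> = (\<Sum>k\<in>J. \<Sum>j\<in>J. \<Sum>i\<in>I. (cnj (f k) * f j) * (cnj (a i k) * a i j))"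
    by (subst sum.swap, rule sum.cong[OF refl], rule sum.swap)
  also have "\<dots> = (\<Sum>k\<in>J. \<Sum>j\<in>J. if k = j then cnj (f k) * f j * C else 0)"
    by (intro sum.cong refl) (simp add: sum_distrib_left[symmetric] orthogonal)
  also have "\<dots> = (\<Sum>k\<in>J. cnj (f k) * f k * C)"
    using \<open>finite J\<close> by simp
  also have "\<dots> = complex_of_real (C * (\<Sum>j\<in>J. (cmod (f j))\<^sup>2))"
    by (simp add: complex_norm_square sum_distrib_left mult_ac del: of_real_power)
  finally show ?thesis using of_real_eq_iff by blast
qed

lemma is_unitary_sum_squares:
  assumes "is_unitary n A"
  shows "(\<Sum>i<n. (cmod (\<Sum>j<n. A $$ (i,j) * f j))\<^sup>2) = (\<Sum>j<n. (cmod (f j))\<^sup>2)"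
proof -
  have A: "A \<in> carrier_mat n n" "adj A * A = 1\<^sub>m n" using assms by (auto simp: is_unitary_def)
  have "(\<Sum>k<n. cnj (A $$ (k,i)) * A $$ (k,j)) = (if i = j then 1 else 0)"
    if ij: "i < n" "j < n" for i j
  proof -
    have "(\<Sum>k<n. cnj (A $$ (k,i)) * A $$ (k,j)) = (adj A * A) $$ (i,j)"
      using index_mult_mat_sum[OF adj_carrier[OF A(1)] A(1) ij] A(1) ij by (simp add: adj_def)
    then show ?thesis using A(2) ij by simp
  qed
  then have "(\<Sum>i<n. (cmod (\<Sum>j<n. A $$ (i,j) * f j))\<^sup>2) = 1 * (\<Sum>j<n. (cmod (f j))\<^sup>2)"
    by (intro sum_square_orthogonal_columns) auto
  then show ?thesis by simp
qed

lemma is_pure_state_carrier: "is_pure_state n v \<Longrightarrow> v \<in> carrier_vec n"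
  by (simp add: is_pure_state_def)

lemma is_pure_state_iff_cscalar_prod:
  assumes v: "v \<in> carrier_vec n"
  shows "is_pure_state n v \<longleftrightarrow> v \<bullet>c v = 1"
proof -
  have "v \<bullet>c v = complex_of_real (\<Sum>i<n. (cmod (v $ i))\<^sup>2)"
    by (simp add: cscalar_prod_sum[OF v v] complex_norm_square del: of_real_power)
  then show ?thesis using v by (simp add: is_pure_state_def del: of_real_sum)
qed

lemma is_pure_state_unit_vec:
  assumes "i < n"
  shows "is_pure_state n (unit_vec n i)"
proof -
  have "(\<Sum>k<n. (cmod (unit_vec n i $ k))\<^sup>2) = (\<Sum>k<n. if k = i then 1 else 0)"
    using assms by (intro sum.cong) auto
  then show ?thesis using assms by (simp add: is_pure_state_def)
qed

lemma is_pure_state_unitary: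
  assumes A: "is_unitary n A" and v: "is_pure_state n v"
  shows "is_pure_state n (A *\<^sub>v v)"
proof -
  note carriers = is_unitary_carrier[OF A] is_pure_state_carrier[OF v]
  have "(\<Sum>i<n. (cmod ((A *\<^sub>v v) $ i))\<^sup>2) = (\<Sum>i<n. (cmod (\<Sum>j<n. A $$ (i,j) * v $ j))\<^sup>2)"
    by (intro sum.cong refl) (simp only: index_mult_mat_vec_sum[OF carriers] lessThan_iff)
  then show ?thesis
    using carriers v by (simp only: is_unitary_sum_squares[OF A]) (simp add: is_pure_state_def)
qed

lemma kron_carrier:
  "A \<in> carrier_mat a b \<Longrightarrow> B \<in> carrier_mat c e \<Longrightarrow> kron A B \<in> carrier_mat (a*c) (b*e)"
  by (auto simp: kron_def)

lemma index_kron: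
  assumes "A \<in> carrier_mat n n'" "B \<in> carrier_mat m m'" "a < n" "a' < n'" "b < m" "b' < m'"
  shows "kron A B $$ (a*m+b, a'*m'+b') = A $$ (a,a') * B $$ (b,b')"
  using assms pair_index_less[of a n b m] pair_index_less[of a' n' b' m']
  by (auto simp: kron_def)

lemma eq_mat_pairI:
  assumes "A \<in> carrier_mat (n*m) (n'*m')" "B \<in> carrier_mat (n*m) (n'*m')"
    and "\<And>a b a' b'. a < n \<Longrightarrow> b < m \<Longrightarrow> a' < n' \<Longrightarrow> b' < m' \<Longrightarrow>
      A $$ (a*m+b, a'*m'+b') = B $$ (a*m+b, a'*m'+b')"
  shows "A = B"
proof (rule eq_matI)
  fix i j assume "i < dim_row B" "j < dim_col B"
  then have "i < n*m" "j < n'*m'" using assms(2) by auto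
  then show "A $$ (i,j) = B $$ (i,j)" by (elim pair_index_cases) (simp add: assms(3))
qed (use assms in auto)

lemma adj_kron:
  assumes A: "A \<in> carrier_mat n n'" and B: "B \<in> carrier_mat m m'"
  shows "adj (kron A B) = kron (adj A) (adj B)"
proof (rule eq_mat_pairI)
  show "adj (kron A B) \<in> carrier_mat (n'*m') (n*m)"
      "kron (adj A) (adj B) \<in> carrier_mat (n'*m') (n*m)"
    using A B by (intro adj_carrier kron_carrier; simp)+
  fix a b a' b' assume "a < n'" "b < m'" "a' < n" "b' < m"
  then show "adj (kron A B) $$ (a*m'+b, a'*m+b') = kron (adj A) (adj B) $$ (a*m'+b, a'*m+b')"
    using A B kron_carrier[OF A B] pair_index_less[of a n' b m'] pair_index_less[of a' n b' m]
    by (simp add: index_kron[OF adj_carrier[OF A] adj_carrier[OF B]])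
      (simp add: adj_def index_kron[OF A B])
qed

lemma kron_mult:
  assumes A: "A \<in> carrier_mat n n'" and B: "B \<in> carrier_mat m m'"
    and C: "C \<in> carrier_mat n' n''" and D: "D \<in> carrier_mat m' m''"
  shows "kron A B * kron C D = kron (A * C) (B * D)"
proof (rule eq_mat_pairI)
  note carriers = kron_carrier[OF A B] kron_carrier[OF C D]
  show "kron A B * kron C D \<in> carrier_mat (n*m) (n''*m'')" using carriers by simp
  show "kron (A * C) (B * D) \<in> carrier_mat (n*m) (n''*m'')"
    using A B C D by (simp add: kron_carrier)
  fix a b a' b' assume i: "a < n" "b < m" "a' < n''" "b' < m''"
  have "(kron A B * kron C D) $$ (a*m+b, a'*m''+b')
      = (\<Sum>k<n'. \<Sum>l<m'. (A $$ (a,k) * C $$ (k,a')) * (B $$ (b,l) * D $$ (l,b')))"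
    unfolding sum_mult_index
      index_mult_mat_sum[OF carriers pair_index_less[OF i(1,2)] pair_index_less[OF i(3,4)]]
    using i by (intro sum.cong refl) (simp add: index_kron[OF A B] index_kron[OF C D] mult_ac)
  also have "\<dots> = (A * C) $$ (a,a') * (B * D) $$ (b,b')"
    unfolding index_mult_mat_sum[OF A C i(1,3)] index_mult_mat_sum[OF B D i(2,4)] sum_product ..
  also have "\<dots> = kron (A * C) (B * D) $$ (a*m+b, a'*m''+b')"
    using A B C D i by (simp add: index_kron[of _ n n'' _ m m''])
  finally show "(kron A B * kron C D) $$ (a*m+b, a'*m''+b')
      = kron (A * C) (B * D) $$ (a*m+b, a'*m''+b')" .
qed

lemma kron_one: "kron (1\<^sub>m n) (1\<^sub>m m) = 1\<^sub>m (n*m)"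
proof (rule eq_mat_pairI[of _ n m n m])
  fix a b a' b' assume i: "a < n" "b < m" "a' < n" "b' < m"
  have "a*m+b = a'*m+b' \<longleftrightarrow> a = a' \<and> b = b'"
  proof
    assume "a*m+b = a'*m+b'"
    then have "(a*m+b) div m = (a'*m+b') div m" "(a*m+b) mod m = (a'*m+b') mod m" by simp_all
    then show "a = a' \<and> b = b'" using i by simp
  qed simp
  then show "kron (1\<^sub>m n) (1\<^sub>m m) $$ (a*m+b, a'*m+b') = 1\<^sub>m (n*m) $$ (a*m+b, a'*m+b')"
    using i pair_index_less[of a n b m] pair_index_less[of a' n b' m]
    by (auto simp: index_kron[of _ n n _ m m])
qed (auto intro: kron_carrier)

lemma is_unitary_kron:
  assumes "is_unitary n A" "is_unitary m B"
  shows "is_unitary (n*m) (kron A B)"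
proof (rule is_unitaryI)
  note carriers = assms[THEN is_unitary_carrier]
  show "kron A B \<in> carrier_mat (n*m) (n*m)" using carriers by (rule kron_carrier)
  show "kron A B * adj (kron A B) = 1\<^sub>m (n*m)"
    using assms by (simp add: adj_kron[OF carriers] kron_mult[OF carriers carriers[THEN adj_carrier]]
        kron_one is_unitary_def)
qed

lemma index_kron_one_mult_vec:
  assumes A: "A \<in> carrier_mat n n" and v: "v \<in> carrier_vec (n*W)" and a: "a < n" and w: "w < W"
  shows "(kron A (1\<^sub>m W) *\<^sub>v v) $ (a*W+w) = (A *\<^sub>v vec n (\<lambda>b. v $ (b*W+w))) $ a"
proof -
  have "(kron A (1\<^sub>m W) *\<^sub>v v) $ (a*W+w)
      = (\<Sum>b<n. \<Sum>w'<W. kron A (1\<^sub>m W) $$ (a*W+w, b*W+w') * v $ (b*W+w'))"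
    unfolding index_mult_mat_vec_sum[OF kron_carrier[OF A one_carrier_mat] v pair_index_less[OF a w]]
    by (rule sum_mult_index)
  also have "\<dots> = (\<Sum>b<n. \<Sum>w'<W. if w' = w then A $$ (a,b) * v $ (b*W+w) else 0)"
    using a w by (intro sum.cong refl) (auto simp: index_kron[OF A one_carrier_mat])
  also have "\<dots> = (\<Sum>b<n. A $$ (a,b) * v $ (b*W+w))" using w by simp
  also have "\<dots> = (A *\<^sub>v vec n (\<lambda>b. v $ (b*W+w))) $ a"
    by (simp add: index_mult_mat_vec_sum[OF A vec_carrier a])
  finally show ?thesis .
qed

definition vkron :: "complex vec \<Rightarrow> complex vec \<Rightarrow> complex vec" where
  "vkron x y = vec (dim_vec x * dim_vec y) (\<lambda>i. x $ (i div dim_vec y) * y $ (i mod dim_vec y))"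

lemma vkron_carrier: "x \<in> carrier_vec n \<Longrightarrow> y \<in> carrier_vec m \<Longrightarrow> vkron x y \<in> carrier_vec (n*m)"
  by (auto simp: vkron_def)

lemma index_vkron:
  assumes "x \<in> carrier_vec n" "y \<in> carrier_vec m" "a < n" "b < m"
  shows "vkron x y $ (a*m+b) = x $ a * y $ b"
  using assms pair_index_less[of a n b m] by (auto simp: vkron_def)

lemma eq_vec_pairI:
  assumes "x \<in> carrier_vec (n*m)" "y \<in> carrier_vec (n*m)"
    and "\<And>a b. a < n \<Longrightarrow> b < m \<Longrightarrow> x $ (a*m+b) = y $ (a*m+b)"
  shows "x = y"
proof (rule eq_vecI)
  fix i assume "i < dim_vec y"
  then have "i < n*m" using assms(2) by auto
  then show "x $ i = y $ i" by (elim pair_index_cases) (simp add: assms(3))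
qed (use assms in auto)

lemma vkron_assoc:
  assumes x: "x \<in> carrier_vec n" and y: "y \<in> carrier_vec m" and z: "z \<in> carrier_vec k"
  shows "vkron (vkron x y) z = vkron x (vkron y z)"
proof (rule eq_vec_pairI[of _ "n*m" k])
  note carriers = vkron_carrier[OF x y] vkron_carrier[OF y z]
  show "vkron (vkron x y) z \<in> carrier_vec (n*m*k)" by (rule vkron_carrier[OF carriers(1) z])
  show "vkron x (vkron y z) \<in> carrier_vec (n*m*k)"
    using vkron_carrier[OF x carriers(2)] by (simp add: mult.assoc)
  fix i e assume "i < n*m" and e: "e < k"
  then obtain a b where ab: "a < n" "b < m" "i = a*m+b" by (elim pair_index_cases)
  have "vkron (vkron x y) z $ (i*k+e) = x $ a * y $ b * z $ e"
    using index_vkron[OF carriers(1) z \<open>i < n*m\<close> e] index_vkron[OF x y ab(1,2)] ab by simp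
  also have "\<dots> = vkron x (vkron y z) $ (a*(m*k) + (b*k+e))"
    using index_vkron[OF x carriers(2) ab(1) pair_index_less[OF ab(2) e]]
      index_vkron[OF y z ab(2) e] by simp
  also have "a*(m*k) + (b*k+e) = i*k+e" using ab by (simp add: algebra_simps)
  finally show "vkron (vkron x y) z $ (i*k+e) = vkron x (vkron y z) $ (i*k+e)" .
qed

lemma vkron_unit_vec:
  assumes "0 < n" "0 < m"
  shows "vkron (unit_vec n 0) (unit_vec m 0) = unit_vec (n*m) 0"
proof (rule eq_vec_pairI)
  fix a b assume ab: "a < n" "b < m"
  show "vkron (unit_vec n 0) (unit_vec m 0) $ (a*m+b) = unit_vec (n*m) 0 $ (a*m+b)"
    using ab assms pair_index_less[OF ab] index_vkron[OF unit_vec_carrier unit_vec_carrier ab, of 0 0]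
    by (auto simp: unit_vec_def)
qed (auto intro: vkron_carrier)

lemma kron_mult_vkron:
  assumes A: "A \<in> carrier_mat n n'" and B: "B \<in> carrier_mat m m'"
    and x: "x \<in> carrier_vec n'" and y: "y \<in> carrier_vec m'"
  shows "kron A B *\<^sub>v vkron x y = vkron (A *\<^sub>v x) (B *\<^sub>v y)"
proof (rule eq_vec_pairI)
  note carriers = kron_carrier[OF A B] vkron_carrier[OF x y]
  show "kron A B *\<^sub>v vkron x y \<in> carrier_vec (n*m)" using carriers by (rule mult_mat_vec_carrier)
  show "vkron (A *\<^sub>v x) (B *\<^sub>v y) \<in> carrier_vec (n*m)" using assms by (intro vkron_carrier) auto
  fix a b assume ab: "a < n" "b < m"
  have "(kron A B *\<^sub>v vkron x y) $ (a*m+b)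
      = (\<Sum>k<n'. \<Sum>l<m'. (A $$ (a,k) * x $ k) * (B $$ (b,l) * y $ l))"
    unfolding index_mult_mat_vec_sum[OF carriers pair_index_less[OF ab]] sum_mult_index using ab
    by (intro sum.cong refl) (simp add: index_kron[OF A B] index_vkron[OF x y])
  also have "\<dots> = (A *\<^sub>v x) $ a * (B *\<^sub>v y) $ b"
    unfolding index_mult_mat_vec_sum[OF A x ab(1)] index_mult_mat_vec_sum[OF B y ab(2)]
    by (rule sum_product[symmetric])
  also have "\<dots> = vkron (A *\<^sub>v x) (B *\<^sub>v y) $ (a*m+b)"
    by (rule index_vkron[symmetric]) (use assms ab in auto)
  finally show "(kron A B *\<^sub>v vkron x y) $ (a*m+b) = vkron (A *\<^sub>v x) (B *\<^sub>v y) $ (a*m+b)" .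
qed

lemma cscalar_prod_vkron:
  assumes x: "x \<in> carrier_vec n" "x' \<in> carrier_vec n"
    and y: "y \<in> carrier_vec m" "y' \<in> carrier_vec m"
  shows "vkron x y \<bullet>c vkron x' y' = (x \<bullet>c x') * (y \<bullet>c y')"
proof -
  have "vkron x y \<bullet>c vkron x' y' = (\<Sum>a<n. \<Sum>b<m. (x $ a * cnj (x' $ a)) * (y $ b * cnj (y' $ b)))"
    unfolding sum_mult_index
      cscalar_prod_sum[OF vkron_carrier[OF x(1) y(1)] vkron_carrier[OF x(2) y(2)]]
    by (intro sum.cong refl) (simp add: index_vkron[OF x(1) y(1)] index_vkron[OF x(2) y(2)] mult_ac)
  then show ?thesis by (simp only: cscalar_prod_sum[OF x] cscalar_prod_sum[OF y] sum_product)
qed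

lemma is_pure_state_vkron:
  assumes "is_pure_state n x" "is_pure_state m y"
  shows "is_pure_state (n*m) (vkron x y)"
proof -
  note carriers = assms[THEN is_pure_state_carrier]
  show ?thesis
    using assms by (simp add: is_pure_state_iff_cscalar_prod[OF vkron_carrier[OF carriers]]
        cscalar_prod_vkron[OF carriers(1,1) carriers(2,2)]
        is_pure_state_iff_cscalar_prod[OF carriers(1)]
        is_pure_state_iff_cscalar_prod[OF carriers(2)])
qed

lemma ptrace_A_vkron:
  assumes x: "is_pure_state a x" and y: "y \<in> carrier_vec b"
  shows "ptrace_A a b (outer (vkron x y)) = outer y"
proof (rule eq_matI)
  note carrier = is_pure_state_carrier[OF x]
  fix i j assume "i < dim_row (outer y)" "j < dim_col (outer y)"
  then have ij: "i < b" "j < b" using y by (auto simp: outer_def)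
  have "ptrace_A a b (outer (vkron x y)) $$ (i,j)
      = (\<Sum>k<a. (x $ k * cnj (x $ k)) * (y $ i * cnj (y $ j)))"
    using ij vkron_carrier[OF carrier y] pair_index_less[of _ a _ b]
    by (simp add: ptrace_A_def outer_def index_vkron[OF carrier y] mult_ac cong: sum.cong_simp)
  also have "\<dots> = (x \<bullet>c x) * (y $ i * cnj (y $ j))"
    by (simp add: cscalar_prod_sum[OF carrier carrier] sum_distrib_right)
  finally show "ptrace_A a b (outer (vkron x y)) $$ (i,j) = outer y $$ (i,j)"
    using x ij y by (simp add: is_pure_state_iff_cscalar_prod[OF carrier] outer_def)
qed (use y in \<open>auto simp: ptrace_A_def outer_def\<close>)

section \<open>State preparation by reflections\<close>

definition reflection :: "complex vec \<Rightarrow> complex mat" where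
  "reflection g = 1\<^sub>m (dim_vec g) - outer g"

lemma reflection_carrier: "g \<in> carrier_vec n \<Longrightarrow> reflection g \<in> carrier_mat n n"
  by (auto simp: reflection_def outer_def)

lemma adj_reflection: "adj (reflection g) = reflection g"
  by (intro eq_matI) (auto simp: adj_def reflection_def outer_def)

lemma outer_mult_outer:
  assumes "g \<in> carrier_vec n"
  shows "outer g * outer g = (g \<bullet>c g) \<cdot>\<^sub>m outer g"
proof (rule eq_matI)
  note carriers = outer_carrier[OF assms]
  fix i j assume "i < dim_row ((g \<bullet>c g) \<cdot>\<^sub>m outer g)" "j < dim_col ((g \<bullet>c g) \<cdot>\<^sub>m outer g)"
  then have ij: "i < n" "j < n" using carriers by auto
  have "(outer g * outer g) $$ (i,j) = (\<Sum>k<n. (g $ k * cnj (g $ k)) * (g $ i * cnj (g $ j)))"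
    unfolding index_mult_mat_sum[OF carriers carriers ij] using assms ij
    by (intro sum.cong) (auto simp: outer_def)
  then show "(outer g * outer g) $$ (i,j) = ((g \<bullet>c g) \<cdot>\<^sub>m outer g) $$ (i,j)"
    using assms ij
    by (simp add: cscalar_prod_sum[OF assms assms] sum_distrib_right[symmetric] outer_def)
qed (simp_all add: outer_def)

lemma is_unitary_reflection:
  assumes g: "g \<in> carrier_vec n" and norm: "g \<bullet>c g = 2"
  shows "is_unitary n (reflection g)"
proof (rule is_unitaryI)
  let ?R = "reflection g" and ?O = "outer g"
  show R: "?R \<in> carrier_mat n n" by (rule reflection_carrier[OF g])
  have O: "?O \<in> carrier_mat n n" by (rule outer_carrier[OF g])
  have "?R * adj ?R = ?R * 1\<^sub>m n - ?R * ?O"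
    using g by (subst adj_reflection, subst (2) reflection_def)
      (simp add: mult_minus_distrib_mat[OF R one_carrier_mat O])
  also have "?R * ?O = ?O - (2 :: complex) \<cdot>\<^sub>m ?O"
    using g O minus_mult_distrib_mat[OF one_carrier_mat O O]
    by (simp add: reflection_def outer_mult_outer[OF g] norm)
  also have "?R * 1\<^sub>m n - (?O - (2 :: complex) \<cdot>\<^sub>m ?O) = 1\<^sub>m n"
    using g R O by (intro eq_matI) (auto simp: reflection_def)
  finally show "?R * adj ?R = 1\<^sub>m n" .
qed

lemma reflection_mult_vec:
  assumes g: "g \<in> carrier_vec n" and v: "v \<in> carrier_vec n"
  shows "reflection g *\<^sub>v v = v - (v \<bullet>c g) \<cdot>\<^sub>v g"
proof -
  have O: "outer g \<in> carrier_mat n n" by (rule outer_carrier[OF g])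
  have "outer g *\<^sub>v v = (v \<bullet>c g) \<cdot>\<^sub>v g"
  proof (rule eq_vecI)
    fix i assume "i < dim_vec ((v \<bullet>c g) \<cdot>\<^sub>v g)"
    then have i: "i < n" using g by simp
    have "(outer g *\<^sub>v v) $ i = (\<Sum>k<n. (v $ k * cnj (g $ k)) * g $ i)"
      unfolding index_mult_mat_vec_sum[OF O v i] using g i
      by (intro sum.cong) (auto simp: outer_def)
    then show "(outer g *\<^sub>v v) $ i = ((v \<bullet>c g) \<cdot>\<^sub>v g) $ i"
      using g i by (simp add: cscalar_prod_sum[OF v g] sum_distrib_right)
  qed (use g in \<open>simp add: outer_def\<close>)
  then show ?thesis
    using g v minus_mult_distrib_mat_vec[OF one_carrier_mat O v] by (simp add: reflection_def)
qed

lemma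
  assumes x: "is_pure_state n x" and y: "is_pure_state n y" and orth: "x \<bullet>c y = 0"
  shows is_unitary_reflection_diff: "is_unitary n (reflection (x - y))"
    and reflection_diff_mult_vec: "reflection (x - y) *\<^sub>v x = y"
proof -
  note carriers = x[THEN is_pure_state_carrier] y[THEN is_pure_state_carrier]
  have diff: "x - y \<in> carrier_vec n" using carriers by simp
  have unit: "x \<bullet>c x = 1" "y \<bullet>c y = 1"
    using x y is_pure_state_iff_cscalar_prod[OF carriers(1)]
      is_pure_state_iff_cscalar_prod[OF carriers(2)] by auto
  have "y \<bullet>c x = cnj (x \<bullet>c y)"
    unfolding cscalar_prod_sum[OF carriers] cscalar_prod_sum[OF carriers(2,1)] cnj_sum
    by (simp add: mult.commute)
  then have orth_sym: "y \<bullet>c x = 0" using orth by simp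
  have "(x - y) \<bullet>c (x - y) = 2"
    by (simp add: cscalar_prod_diff(1)[OF carriers diff]
        cscalar_prod_diff(2)[OF carriers carriers(1)] cscalar_prod_diff(2)[OF carriers carriers(2)]
        unit orth orth_sym)
  then show "is_unitary n (reflection (x - y))" by (rule is_unitary_reflection[OF diff])
  have "reflection (x - y) *\<^sub>v x = x - 1 \<cdot>\<^sub>v (x - y)"
    by (simp add: reflection_mult_vec[OF diff carriers(1)]
        cscalar_prod_diff(2)[OF carriers carriers(1)] unit orth)
  then show "reflection (x - y) *\<^sub>v x = y" using carriers by (auto intro!: eq_vecI)
qed

definition reflection_axis :: "nat \<Rightarrow> complex vec \<Rightarrow> complex vec" where
  "reflection_axis d \<psi> = unit_vec (2*d*d) 0 - vkron (unit_vec (2*d) 1) \<psi>"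

definition reflection_oracle :: "nat \<Rightarrow> complex vec \<Rightarrow> complex mat" where
  "reflection_oracle d \<psi> = reflection (reflection_axis d \<psi>)"

lemma reflection_axis_carrier: "\<psi> \<in> carrier_vec d \<Longrightarrow> reflection_axis d \<psi> \<in> carrier_vec (2*d*d)"
  unfolding reflection_axis_def by (intro minus_carrier_vec unit_vec_carrier vkron_carrier)

lemma reflection_oracle_carrier:
  "\<psi> \<in> carrier_vec d \<Longrightarrow> reflection_oracle d \<psi> \<in> carrier_mat (2*d*d) (2*d*d)"
  unfolding reflection_oracle_def by (intro reflection_carrier reflection_axis_carrier)

lemma level_index_less:
  fixes d j :: nat
  assumes "j < d"
  shows "d + j < 2*d*d"
  using pair_index_less[of 1 "2*d" j d] assms by simp

lemma cscalar_prod_vkron_unit_vec_1: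
  assumes d_pos: "0 < d" and \<psi>: "\<psi> \<in> carrier_vec d" and v: "v \<in> carrier_vec (2*d*d)"
  shows "v \<bullet>c vkron (unit_vec (2*d) 1) \<psi> = (\<Sum>j<d. cnj (\<psi> $ j) * v $ (d+j))"
proof -
  have "v \<bullet>c vkron (unit_vec (2*d) 1) \<psi>
      = (\<Sum>k<2*d. \<Sum>j<d. v $ (k*d+j) * cnj (vkron (unit_vec (2*d) 1) \<psi> $ (k*d+j)))"
    unfolding cscalar_prod_sum[OF v vkron_carrier[OF unit_vec_carrier \<psi>]] by (rule sum_mult_index)
  also have "\<dots> = (\<Sum>k<2*d. if k = 1 then \<Sum>j<d. cnj (\<psi> $ j) * v $ (d+j) else 0)"
    using d_pos by (intro sum.cong refl)
      (auto simp: index_vkron[OF unit_vec_carrier \<psi>] mult.commute)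
  finally show ?thesis using d_pos by simp
qed

lemma cscalar_prod_reflection_axis:
  assumes d_pos: "0 < d" and \<psi>: "\<psi> \<in> carrier_vec d" and v: "v \<in> carrier_vec (2*d*d)"
  shows "v \<bullet>c reflection_axis d \<psi> = v $ 0 - (\<Sum>j<d. cnj (\<psi> $ j) * v $ (d+j))"
proof -
  let ?e = "unit_vec (2*d*d) 0" and ?y = "vkron (unit_vec (2*d) 1) \<psi>"
  have e: "?e \<in> carrier_vec (2*d*d)" and y: "?y \<in> carrier_vec (2*d*d)"
    using vkron_carrier[OF unit_vec_carrier \<psi>, of "2*d" 1] by simp_all
  have "v \<bullet>c reflection_axis d \<psi> = v \<bullet>c ?e - v \<bullet>c ?y"
    unfolding reflection_axis_def by (rule cscalar_prod_diff(2)[OF e y v])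
  also have "v \<bullet>c ?e = (\<Sum>i<2*d*d. if i = 0 then v $ 0 else 0)"
    unfolding cscalar_prod_sum[OF v e] by (intro sum.cong) (auto simp: unit_vec_def)
  finally show ?thesis using cscalar_prod_vkron_unit_vec_1[OF assms] d_pos by simp
qed

lemma index_reflection_axis:
  assumes d_pos: "0 < d" and \<psi>: "\<psi> \<in> carrier_vec d"
  shows "reflection_axis d \<psi> $ 0 = 1"
    and "j < d \<Longrightarrow> reflection_axis d \<psi> $ (d+j) = - \<psi> $ j"
    and "a < 2*d*d \<Longrightarrow> a \<noteq> 0 \<Longrightarrow> a < d \<or> 2*d \<le> a \<Longrightarrow> reflection_axis d \<psi> $ a = 0"
proof -
  have y: "dim_vec (vkron (unit_vec (2*d) 1) \<psi>) = 2*d*d" using \<psi> by (simp add: vkron_def)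
  have axis: "reflection_axis d \<psi> $ (k*d+j)
      = (if k = 0 \<and> j = 0 then 1 else 0) - (if k = 1 then \<psi> $ j else 0)"
    if "k < 2*d" "j < d" for k j
    using that d_pos y pair_index_less[OF that] index_vkron[OF unit_vec_carrier \<psi> that]
    by (auto simp: reflection_axis_def)
  show "reflection_axis d \<psi> $ 0 = 1" using axis[of 0 0] d_pos by simp
  show "reflection_axis d \<psi> $ (d+j) = - \<psi> $ j" if "j < d" using axis[of 1 j] that by simp
  show "reflection_axis d \<psi> $ a = 0" if a: "a < 2*d*d" "a \<noteq> 0" "a < d \<or> 2*d \<le> a"
  proof -
    obtain k j where kj: "k < 2*d" "j < d" "a = k*d+j" using a(1) by (rule pair_index_cases)
    have "k \<noteq> 1" using a(3) kj by auto
    then show ?thesis using axis[OF kj(1,2)] a(2) kj(3) by auto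
  qed
qed

lemma state_prep_reflection_oracle:
  assumes d_pos: "0 < d" and \<psi>: "is_pure_state d \<psi>"
  shows "state_prep d \<psi> (reflection_oracle d \<psi>)"
proof -
  let ?e = "unit_vec (2*d*d) 0" and ?y = "vkron (unit_vec (2*d) 1) \<psi>"
  have e: "is_pure_state (2*d*d) ?e" and y: "is_pure_state (2*d*d) ?y"
    using d_pos by (intro is_pure_state_unit_vec is_pure_state_vkron \<psi>; simp)+
  have "?e \<bullet>c ?y = 0"
    using d_pos level_index_less
    by (subst cscalar_prod_vkron_unit_vec_1[OF d_pos is_pure_state_carrier[OF \<psi>]]) auto
  note exchange = is_unitary_reflection_diff[OF e y this] reflection_diff_mult_vec[OF e y this]
  have "ptrace_A (2*d) d (outer ?y) = outer \<psi>"
    using d_pos by (intro ptrace_A_vkron is_pure_state_unit_vec is_pure_state_carrier[OF \<psi>]) simp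
  then show ?thesis
    using exchange by (simp add: state_prep_def reflection_oracle_def reflection_axis_def)
qed

lemma query_op_reflection_oracle:
  assumes d_pos: "0 < d" and \<psi>: "\<psi> \<in> carrier_vec d" and q: "q \<in> {QU, QUdag}"
    and v: "v \<in> carrier_vec (2*d*d*W)" and i: "i < 2*d*d*W"
  shows "(query_op q (reflection_oracle d \<psi>) W *\<^sub>v v) $ i
    = v $ i - (v $ (i mod W) - (\<Sum>j<d. cnj (\<psi> $ j) * v $ ((d+j)*W + i mod W)))
        * reflection_axis d \<psi> $ (i div W)"
proof -
  let ?U = "reflection_oracle d \<psi>"
  obtain a w where aw: "a < 2*d*d" "w < W" "i = a*W+w" using i by (rule pair_index_cases)
  define s where "s = vec (2*d*d) (\<lambda>b. v $ (b*W+w))"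
  have s: "s \<in> carrier_vec (2*d*d)" by (simp add: s_def)
  have "query_op q ?U W = kron ?U (1\<^sub>m W)"
    using q by (auto simp: query_op_def reflection_oracle_def adj_reflection)
  then have "(query_op q ?U W *\<^sub>v v) $ i = (?U *\<^sub>v s) $ a"
    using index_kron_one_mult_vec[OF reflection_oracle_carrier[OF \<psi>] v aw(1,2)] aw(3)
    by (simp add: s_def)
  also have "\<dots> = s $ a - (s $ 0 - (\<Sum>j<d. cnj (\<psi> $ j) * s $ (d+j))) * reflection_axis d \<psi> $ a"
    using aw(1) s reflection_axis_carrier[OF \<psi>]
    by (simp add: reflection_oracle_def reflection_mult_vec[OF reflection_axis_carrier[OF \<psi>] s]
        cscalar_prod_reflection_axis[OF d_pos \<psi> s])
  also have "\<dots> = v $ i - (v $ (i mod W) - (\<Sum>j<d. cnj (\<psi> $ j) * v $ ((d+j)*W + i mod W)))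
      * reflection_axis d \<psi> $ (i div W)"
    using d_pos aw level_index_less by (simp add: s_def)
  finally show ?thesis .
qed

lemma query_op_carrier:
  assumes "U \<in> carrier_mat n n"
  shows "query_op q U W \<in> carrier_mat (n*W) (n*W)"
  unfolding query_op_def
  using assms by (intro kron_carrier one_carrier_mat)
    (auto simp: adj_carrier conj_mat_carrier split: query.split)

section \<open>Walsh expansions\<close>

definition sign_at :: "nat set \<Rightarrow> nat \<Rightarrow> complex" where
  "sign_at X j = (if j \<in> X then -1 else 1)"

definition toggle :: "nat set \<Rightarrow> nat \<Rightarrow> nat set" where
  "toggle S j = (if j \<in> S then S - {j} else insert j S)"

definition walsh :: "nat set \<Rightarrow> nat set \<Rightarrow> complex" where
  "walsh S X = (\<Prod>j\<in>S. sign_at X j)"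

definition walsh_sum :: "nat \<Rightarrow> (nat set \<Rightarrow> complex) \<Rightarrow> nat set \<Rightarrow> complex" where
  "walsh_sum d f X = (\<Sum>S\<in>Pow {..<d}. walsh S X * f S)"

definition mass :: "nat \<Rightarrow> (nat set \<Rightarrow> complex) \<Rightarrow> real" where
  "mass d f = (\<Sum>S\<in>Pow {..<d}. (cmod (f S))\<^sup>2)"

lemma sign_at_simps [simp]:
  "(sign_at X j)\<^sup>2 = 1" "cnj (sign_at X j) = sign_at X j" "cmod (sign_at X j) = 1"
  by (simp_all add: sign_at_def)

lemma toggle_toggle [simp]: "toggle (toggle S j) j = S"
  by (auto simp: toggle_def)

lemma mem_toggle [simp]: "j \<in> toggle S j \<longleftrightarrow> j \<notin> S"
  by (simp add: toggle_def)

lemma card_toggle: "card S \<le> Suc (card (toggle S j))"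
  by (cases "finite S") (auto simp: toggle_def card_insert_if)

lemma prod_toggle:
  assumes "finite S"
  shows "j \<in> S \<Longrightarrow> \<beta> j * prod \<beta> (toggle S j) = prod \<beta> S"
    and "j \<notin> S \<Longrightarrow> prod \<beta> (toggle S j) = \<beta> j * prod \<beta> S"
  using assms by (simp_all add: toggle_def prod.remove[of S j])

lemma walsh_toggle:
  assumes "finite S"
  shows "walsh (toggle S j) X = sign_at X j * walsh S X"
proof (cases "j \<in> S")
  case True
  then have "sign_at X j * walsh S X = (sign_at X j)\<^sup>2 * walsh (toggle S j) X"
    unfolding walsh_def prod_toggle(1)[OF assms True, symmetric]
    by (simp only: power2_eq_square mult.assoc)
  then show ?thesis by simp
qed (simp add: walsh_def prod_toggle(2)[OF assms])

lemma walsh_commute: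
  assumes "finite S" "finite X"
  shows "walsh S X = walsh X S"
  using assms prod.inter_restrict[of S "\<lambda>_. -1 :: complex" X]
    prod.inter_restrict[of X "\<lambda>_. -1 :: complex" S]
  by (simp add: walsh_def sign_at_def[abs_def] Int_commute)

lemma sum_walsh_mult_walsh:
  assumes D: "finite D" and "S \<subseteq> D" "T \<subseteq> D"
  shows "(\<Sum>X\<in>Pow D. walsh S X * walsh T X) = (if S = T then 2 ^ card D else 0)"
proof -
  have fin: "finite S" "finite T" using assms finite_subset by auto
  have "(\<Sum>X\<in>Pow D. walsh S X * walsh T X) = (\<Sum>X\<in>Pow D. \<Prod>j\<in>X. sign_at S j * sign_at T j)"
  proof (intro sum.cong refl)
    fix X assume "X \<in> Pow D"
    then have "finite X" using D finite_subset by auto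
    then show "walsh S X * walsh T X = (\<Prod>j\<in>X. sign_at S j * sign_at T j)"
      by (simp add: walsh_commute[OF fin(1)] walsh_commute[OF fin(2)])
        (simp add: walsh_def prod.distrib)
  qed
  also have "\<dots> = (\<Prod>j\<in>D. sign_at S j * sign_at T j + 1)"
    by (simp add: prod_add[OF D])
  also have "\<dots> = (if S = T then 2 ^ card D else 0)"
  proof (cases "S = T")
    case False
    then obtain j where "j \<in> D" "(j \<in> S) \<noteq> (j \<in> T)" using assms by blast
    then have "j \<in> D" "sign_at S j * sign_at T j + 1 = 0" by (auto simp: sign_at_def)
    then have "(\<Prod>j\<in>D. sign_at S j * sign_at T j + 1) = 0" using D by (intro prod_zero) auto
    then show ?thesis using False by simp
  qed (simp flip: power2_eq_square)
  finally show ?thesis .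
qed

lemma mass_nonneg: "0 \<le> mass d f"
  by (simp add: mass_def sum_nonneg)

lemma parseval: "(\<Sum>X\<in>Pow {..<d}. (cmod (walsh_sum d f X))\<^sup>2) = 2 ^ d * mass d f"
  unfolding walsh_sum_def mass_def
proof (rule sum_square_orthogonal_columns)
  fix S T assume "S \<in> Pow {..<d}" "T \<in> Pow {..<d}"
  then have "S \<subseteq> {..<d}" "T \<subseteq> {..<d}" by auto
  moreover have "cnj (walsh S X) = walsh S X" for X by (simp add: walsh_def)
  ultimately show "(\<Sum>X\<in>Pow {..<d}. cnj (walsh S X) * walsh T X)
      = (if S = T then complex_of_real (2 ^ d) else 0)"
    by (simp only: sum_walsh_mult_walsh[OF finite_lessThan]) simp
qed simp

lemma sum_Pow_toggle:
  assumes "j < d"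
  shows "(\<Sum>S\<in>Pow {..<d}. f (toggle S j)) = (\<Sum>S\<in>Pow {..<d}. f S)"
  using assms by (intro sum.reindex_bij_witness[where i = "\<lambda>S. toggle S j" and j = "\<lambda>S. toggle S j"])
    (auto simp: toggle_def)

lemma mass_toggle: "j < d \<Longrightarrow> mass d (\<lambda>S. f (toggle S j)) = mass d f"
  unfolding mass_def by (rule sum_Pow_toggle[where f = "\<lambda>S. (cmod (f S))\<^sup>2"])

lemma sum_toggle_square:
  "(\<Sum>S\<in>Pow {..<d}. \<Sum>j<d. (cmod (g j (toggle S j)))\<^sup>2) = (\<Sum>j<d. mass d (g j))"
  by (subst sum.swap) (simp add: mass_toggle flip: mass_def)

lemma walsh_sum_toggle:
  assumes "j < d"
  shows "walsh_sum d (\<lambda>S. f (toggle S j)) X = sign_at X j * walsh_sum d f X"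
proof -
  have "walsh_sum d (\<lambda>S. f (toggle S j)) X = (\<Sum>S\<in>Pow {..<d}. walsh (toggle S j) X * f S)"
    unfolding walsh_sum_def
    using sum_Pow_toggle[OF assms, of "\<lambda>S. walsh (toggle S j) X * f S"] by simp
  also have "\<dots> = (\<Sum>S\<in>Pow {..<d}. sign_at X j * (walsh S X * f S))"
    by (intro sum.cong refl) (simp add: walsh_toggle finite_subset[OF _ finite_lessThan])
  finally show ?thesis by (simp add: walsh_sum_def sum_distrib_left)
qed

lemma walsh_sum_diff: "walsh_sum d (\<lambda>S. f S - g S) X = walsh_sum d f X - walsh_sum d g X"
  by (simp add: walsh_sum_def algebra_simps sum_subtractf)

lemma walsh_sum_cmult: "walsh_sum d (\<lambda>S. c * f S) X = c * walsh_sum d f X"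
  by (simp add: walsh_sum_def sum_distrib_left mult_ac)

lemma walsh_sum_sum: "walsh_sum d (\<lambda>S. \<Sum>k\<in>I. f k S) X = (\<Sum>k\<in>I. walsh_sum d (f k) X)"
  unfolding walsh_sum_def sum_distrib_left by (rule sum.swap)

lemma walsh_sum_empty: "walsh_sum d (\<lambda>S. if S = {} then c else 0) X = c"
proof -
  have "walsh_sum d (\<lambda>S. if S = {} then c else 0) X = (\<Sum>S\<in>Pow {..<d}. if S = {} then c else 0)"
    unfolding walsh_sum_def by (intro sum.cong refl) (auto simp: walsh_def)
  then show ?thesis by simp
qed

lemma norm_sum_mult_square_le:
  fixes c x :: "'a \<Rightarrow> 'b::real_normed_div_algebra"
  shows "(norm (\<Sum>j\<in>A. c j * x j))\<^sup>2 \<le> (\<Sum>j\<in>A. (norm (c j))\<^sup>2) * (\<Sum>j\<in>A. (norm (x j))\<^sup>2)"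
proof -
  have "norm (\<Sum>j\<in>A. c j * x j) \<le> (\<Sum>j\<in>A. norm (c j) * norm (x j))"
    by (rule sum_norm_le) (simp add: norm_mult)
  then have "(norm (\<Sum>j\<in>A. c j * x j))\<^sup>2 \<le> (\<Sum>j\<in>A. norm (c j) * norm (x j))\<^sup>2"
    by (rule power_mono) simp
  also have "\<dots> \<le> (\<Sum>j\<in>A. (norm (c j))\<^sup>2) * (\<Sum>j\<in>A. (norm (x j))\<^sup>2)"
    by (rule Cauchy_Schwarz_ineq_sum)
  finally show ?thesis .
qed

lemma norm_diff_square_le:
  fixes x y :: "'a::real_normed_vector"
  shows "(norm (x - y))\<^sup>2 \<le> 2 * ((norm x)\<^sup>2 + (norm y)\<^sup>2)"
proof -
  have "(norm (x - y))\<^sup>2 \<le> (norm x + norm y)\<^sup>2"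
    by (intro power_mono norm_triangle_ineq4) simp
  also have "\<dots> \<le> 2 * ((norm x)\<^sup>2 + (norm y)\<^sup>2)"
    using sum_squares_bound[of "norm x" "norm y"] by (simp add: power2_sum)
  finally show ?thesis .
qed

text \<open>The value \<open>h i S\<close> is the coefficient of the Walsh function \<open>S\<close> in amplitude \<open>i\<close>.\<close>

type_synonym coefficients = "nat \<Rightarrow> nat set \<Rightarrow> complex"

definition coeff_norm :: "nat \<Rightarrow> nat set \<Rightarrow> coefficients \<Rightarrow> real" where
  "coeff_norm d I h = L2_set (\<lambda>(i,S). cmod (h i S)) (I \<times> Pow {..<d})"

definition degree_le :: "nat \<Rightarrow> coefficients \<Rightarrow> bool" where
  "degree_le K h \<longleftrightarrow> (\<forall>i S. K < card S \<longrightarrow> h i S = 0)"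

definition twist :: "(nat \<Rightarrow> complex) \<Rightarrow> coefficients \<Rightarrow> coefficients" where
  "twist \<beta> h i S = prod \<beta> S * h i S"

definition twist_error ::
  "((nat \<Rightarrow> complex) \<Rightarrow> coefficients \<Rightarrow> coefficients)
    \<Rightarrow> (nat \<Rightarrow> complex) \<Rightarrow> coefficients \<Rightarrow> coefficients" where
  "twist_error F \<beta> h i S = F \<beta> (twist \<beta> h) i S - twist \<beta> (F (\<lambda>_. 1) h) i S"

definition mat_apply :: "nat \<Rightarrow> complex mat \<Rightarrow> coefficients \<Rightarrow> coefficients" where
  "mat_apply N A h i S = (\<Sum>k<N. A $$ (i,k) * h k S)"

lemma coeff_norm_nonneg: "0 \<le> coeff_norm d I h"
  by (simp add: coeff_norm_def)

lemma coeff_norm_square: "(coeff_norm d I h)\<^sup>2 = (\<Sum>i\<in>I. mass d (h i))"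
  by (simp add: coeff_norm_def L2_set_def mass_def sum.cartesian_product case_prod_beta sum_nonneg)

lemma coeff_norm_mono: "finite J \<Longrightarrow> I \<subseteq> J \<Longrightarrow> coeff_norm d I h \<le> coeff_norm d J h"
  by (rule power2_le_imp_le)
    (auto simp: coeff_norm_square coeff_norm_nonneg mass_nonneg intro!: sum_mono2)

lemma coeff_norm_leI:
  assumes "(\<Sum>i\<in>I. mass d (g i)) \<le> c * (\<Sum>i\<in>J. mass d (h i))" "0 \<le> c"
  shows "coeff_norm d I g \<le> sqrt c * coeff_norm d J h"
  by (rule power2_le_imp_le)
    (use assms in \<open>simp_all add: coeff_norm_square power_mult_distrib coeff_norm_nonneg\<close>)

lemma coeff_norm_triangle:
  "coeff_norm d I (\<lambda>i S. f i S + g i S) \<le> coeff_norm d I f + coeff_norm d I g"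
proof -
  have "coeff_norm d I (\<lambda>i S. f i S + g i S)
      \<le> L2_set (\<lambda>x. cmod (case_prod f x) + cmod (case_prod g x)) (I \<times> Pow {..<d})"
    unfolding coeff_norm_def by (rule L2_set_mono) (auto intro: norm_triangle_ineq)
  also have "\<dots> \<le> coeff_norm d I f + coeff_norm d I g"
    unfolding coeff_norm_def split_def by (rule L2_set_triangle_ineq)
  finally show ?thesis .
qed

lemma coeff_norm_minus_commute:
  "coeff_norm d I (\<lambda>i S. f i S - g i S) = coeff_norm d I (\<lambda>i S. g i S - f i S)"
  by (simp add: coeff_norm_def norm_minus_commute)

lemma cmod_prod_unimodular:
  assumes "\<And>j. cmod (\<beta> j) = 1"
  shows "cmod (prod \<beta> S) = 1"
  by (simp add: prod_norm[symmetric] assms)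

lemma coeff_norm_twist:
  assumes "\<And>j. cmod (\<beta> j) = 1"
  shows "coeff_norm d I (twist \<beta> h) = coeff_norm d I h"
  by (simp add: coeff_norm_def twist_def norm_mult cmod_prod_unimodular assms)

lemma coeff_norm_mat_apply:
  assumes "is_unitary N A"
  shows "coeff_norm d {..<N} (mat_apply N A h) = coeff_norm d {..<N} h"
proof -
  have swap: "(\<Sum>i<N. mass d (f i)) = (\<Sum>S\<in>Pow {..<d}. \<Sum>i<N. (cmod (f i S))\<^sup>2)" for f
    unfolding mass_def by (rule sum.swap)
  have "(coeff_norm d {..<N} (mat_apply N A h))\<^sup>2 = (coeff_norm d {..<N} h)\<^sup>2"
    unfolding coeff_norm_square swap mat_apply_def is_unitary_sum_squares[OF assms] ..
  then show ?thesis by (simp add: coeff_norm_nonneg)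
qed

lemma sum_walsh_sum_square:
  "(\<Sum>X\<in>Pow {..<d}. \<Sum>i\<in>I. (cmod (walsh_sum d (h i) X))\<^sup>2) = 2 ^ d * (coeff_norm d I h)\<^sup>2"
  unfolding coeff_norm_square by (subst sum.swap) (simp only: parseval sum_distrib_left)

lemma coeff_norm_pointwise_unitary:
  assumes A: "\<And>X. is_unitary N (A X)"
    and pointwise: "\<And>X i. i < N \<Longrightarrow>
      walsh_sum d (g i) X = (\<Sum>k<N. A X $$ (i,k) * walsh_sum d (h k) X)"
  shows "coeff_norm d {..<N} g = coeff_norm d {..<N} h"
proof -
  have "2 ^ d * (coeff_norm d {..<N} g)\<^sup>2
      = (\<Sum>X\<in>Pow {..<d}. \<Sum>i<N. (cmod (\<Sum>k<N. A X $$ (i,k) * walsh_sum d (h k) X))\<^sup>2)"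
    unfolding sum_walsh_sum_square[symmetric] by (simp add: pointwise)
  also have "\<dots> = 2 ^ d * (coeff_norm d {..<N} h)\<^sup>2"
    unfolding is_unitary_sum_squares[OF A] by (rule sum_walsh_sum_square)
  finally show ?thesis by (simp add: coeff_norm_nonneg)
qed

section \<open>Queries to phase states in the Walsh basis\<close>

definition phase_state :: "nat \<Rightarrow> (nat \<Rightarrow> complex) \<Rightarrow> nat set \<Rightarrow> complex vec" where
  "phase_state d \<beta> X = vec d (\<lambda>j. \<beta> j / sqrt d * sign_at X j)"

abbreviation phase_oracle :: "nat \<Rightarrow> (nat \<Rightarrow> complex) \<Rightarrow> nat set \<Rightarrow> complex mat" where
  "phase_oracle d \<beta> X \<equiv> reflection_oracle d (phase_state d \<beta> X)"

lemma phase_state_carrier: "phase_state d \<beta> X \<in> carrier_vec d"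
  by (simp add: phase_state_def)

lemma index_phase_state: "j < d \<Longrightarrow> phase_state d \<beta> X $ j = \<beta> j / sqrt d * sign_at X j"
  by (simp add: phase_state_def)

lemma is_pure_state_phase_state:
  assumes "0 < d" "\<And>j. cmod (\<beta> j) = 1"
  shows "is_pure_state d (phase_state d \<beta> X)"
  using assms by (simp add: is_pure_state_def phase_state_def norm_mult norm_divide power_divide)

lemma realness_phase_state:
  assumes "0 < d"
  shows "realness d (phase_state d \<beta> X) = (cmod (\<Sum>j<d. (\<beta> j)\<^sup>2) / d)\<^sup>2"
proof -
  have "complex_of_real (sqrt d) ^ 2 = d" by (simp flip: of_real_power)
  then have "(\<Sum>i<d. (phase_state d \<beta> X $ i)\<^sup>2) = (\<Sum>j<d. (\<beta> j)\<^sup>2) / d"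
    by (simp add: index_phase_state power_mult_distrib power_divide sum_divide_distrib)
  then show ?thesis by (simp add: realness_def norm_divide)
qed

locale query_layout =
  fixes d W :: nat
  assumes d_pos: "0 < d" and W_pos: "0 < W"
begin

abbreviation N :: nat where "N \<equiv> 2*d*d*W"

text \<open>The effect of \<open>h \<mapsto> g\<^sup>\<dagger>h\<close>, \<open>f \<mapsto> gf\<close> and \<open>1 - gg\<^sup>\<dagger>\<close> on Walsh coefficients, where \<open>g\<close> is the
  reflection axis of \<open>phase_state d \<beta> X\<close>: multiplication by a sign is a toggle of the label.\<close>

definition overlap :: "(nat \<Rightarrow> complex) \<Rightarrow> coefficients \<Rightarrow> coefficients" where
  "overlap \<beta> h w S = h w S - (\<Sum>j<d. cnj (\<beta> j) / sqrt d * h ((d+j)*W + w) (toggle S j))"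

definition spread :: "(nat \<Rightarrow> complex) \<Rightarrow> coefficients \<Rightarrow> coefficients" where
  "spread \<beta> f i S =
    (if i div W = 0 then f i S
     else if d \<le> i div W \<and> i div W < 2*d
       then - (\<beta> (i div W - d) / sqrt d * f (i mod W) (toggle S (i div W - d)))
     else 0)"

definition query_coeffs :: "(nat \<Rightarrow> complex) \<Rightarrow> coefficients \<Rightarrow> coefficients" where
  "query_coeffs \<beta> h i S = h i S - spread \<beta> (overlap \<beta> h) i S"

lemma spread_low: "w < W \<Longrightarrow> spread \<beta> f w = f w"
  by (simp add: spread_def[abs_def])

lemma spread_level:
  assumes "j < d" "w < W"
  shows "spread \<beta> f ((d+j)*W + w) = (\<lambda>S. - (\<beta> j / sqrt d) * f w (toggle S j))"
  using assms by (simp add: spread_def[abs_def])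

lemma spread_off_levels:
  assumes "i div W \<noteq> 0" "i div W < d \<or> 2*d \<le> i div W"
  shows "spread \<beta> f i = (\<lambda>S. 0)"
  using assms by (auto simp: spread_def[abs_def])

lemma spread_diff: "spread \<beta> (\<lambda>w S. f w S - g w S) i S = spread \<beta> f i S - spread \<beta> g i S"
  by (simp add: spread_def algebra_simps)

lemma query_coeffs_diff:
  "query_coeffs \<beta> (\<lambda>i S. f i S - g i S) i S = query_coeffs \<beta> f i S - query_coeffs \<beta> g i S"
proof -
  have "overlap \<beta> (\<lambda>i S. f i S - g i S) = (\<lambda>w S. overlap \<beta> f w S - overlap \<beta> g w S)"
    by (intro ext) (simp add: overlap_def right_diff_distrib sum_subtractf)
  then show ?thesis by (simp add: query_coeffs_def spread_diff)
qed

lemma sum_levels: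
  fixes F :: "nat \<Rightarrow> 'a::comm_monoid_add"
  shows "(\<Sum>w<W. F w + (\<Sum>j<d. F ((d+j)*W + w))) = sum F ({..<W} \<union> {d*W..<2*d*W})"
proof -
  have "(\<Sum>w<W. \<Sum>j<d. F ((d+j)*W + w)) = (\<Sum>i<d*W. F (d*W + i))"
    by (subst sum.swap) (simp add: sum_mult_index distrib_right add.assoc)
  also have "\<dots> = sum F {d*W..<2*d*W}"
    by (rule sum.reindex_bij_witness[where i = "\<lambda>i. i - d*W" and j = "\<lambda>i. d*W + i"])
      (auto simp: mult.commute)
  finally have "(\<Sum>w<W. F w + (\<Sum>j<d. F ((d+j)*W + w))) = sum F {..<W} + sum F {d*W..<2*d*W}"
    by (simp add: sum.distrib)
  also have "\<dots> = sum F ({..<W} \<union> {d*W..<2*d*W})"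
  proof (rule sum.union_disjoint[symmetric])
    have "w < d*W" if "w < W" for w using that d_pos less_le_trans[of w W "d*W"] by simp
    then show "{..<W} \<inter> {d*W..<2*d*W} = {}" by (auto simp: disjoint_iff not_le)
  qed simp_all
  finally show ?thesis .
qed

lemma levels_subset: "{..<W} \<union> {d*W..<2*d*W} \<subseteq> {..<N}"
  using d_pos by (auto elim!: less_le_trans)

lemma sum_levels_le:
  fixes F :: "nat \<Rightarrow> real"
  assumes "\<And>i. 0 \<le> F i"
  shows "(\<Sum>w<W. F w + (\<Sum>j<d. F ((d+j)*W + w))) \<le> (\<Sum>i<N. F i)"
  unfolding sum_levels using assms levels_subset by (intro sum_mono2) auto

lemma sum_mass_levels:
  assumes vanish: "\<And>i. i div W \<noteq> 0 \<Longrightarrow> i div W < d \<or> 2*d \<le> i div W \<Longrightarrow> g i = (\<lambda>S. 0)"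
  shows "(\<Sum>i<N. mass d (g i)) = (\<Sum>w<W. mass d (g w) + (\<Sum>j<d. mass d (g ((d+j)*W + w))))"
proof -
  have "mass d (g i) = 0" if "i \<notin> {..<W} \<union> {d*W..<2*d*W}" for i
    using that W_pos vanish[of i]
    by (auto simp: mass_def div_eq_0_iff div_less_iff_less_mult less_eq_div_iff_mult_less_eq)
  then show ?thesis
    unfolding sum_levels[of "\<lambda>i. mass d (g i)"]
    by (intro sum.mono_neutral_right levels_subset) auto
qed

lemma walsh_sum_overlap:
  "walsh_sum d (overlap \<beta> h w) X = walsh_sum d (h w) X
     - (\<Sum>j<d. cnj (phase_state d \<beta> X $ j) * walsh_sum d (h ((d+j)*W + w)) X)"
  unfolding overlap_def walsh_sum_diff walsh_sum_sum walsh_sum_cmult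
  by (simp add: walsh_sum_toggle index_phase_state mult_ac)

lemma walsh_sum_spread:
  assumes i: "i < N"
  shows "walsh_sum d (spread \<beta> f i) X
    = walsh_sum d (f (i mod W)) X * reflection_axis d (phase_state d \<beta> X) $ (i div W)"
proof -
  note axis = index_reflection_axis[OF d_pos phase_state_carrier[of d \<beta> X]]
  obtain a w where aw: "a < 2*d*d" "w < W" "i = a*W + w" using i by (rule pair_index_cases)
  consider (low) "a = 0" | (level) j where "j < d" "a = d + j" | (off) "a \<noteq> 0" "a < d \<or> 2*d \<le> a"
  proof (cases "d \<le> a \<and> a < 2*d")
    case True
    then have "a - d < d" "a = d + (a - d)" by auto
    then show ?thesis by (rule that(2))
  qed (use that(1,3) in linarith)
  then have "walsh_sum d (spread \<beta> f i) X
      = walsh_sum d (f w) X * reflection_axis d (phase_state d \<beta> X) $ a"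
  proof cases
    case low
    then show ?thesis using aw axis(1) by (simp add: spread_low)
  next
    case (level j)
    then show ?thesis
      using aw axis(2)[of j]
      by (simp only: spread_level walsh_sum_cmult walsh_sum_toggle index_phase_state) simp
  next
    case off
    then show ?thesis using aw axis(3)[of a] by (simp add: spread_off_levels walsh_sum_def)
  qed
  then show ?thesis using aw by simp
qed

lemma query_op_phase_state:
  assumes q: "q \<in> {QU, QUdag}" and i: "i < N" and v: "v \<in> carrier_vec N"
    and coeffs: "\<And>k. k < N \<Longrightarrow> v $ k = walsh_sum d (h k) X"
  shows "(query_op q (phase_oracle d \<beta> X) W *\<^sub>v v) $ i = walsh_sum d (query_coeffs \<beta> h i) X"
proof -
  have w: "i mod W < W" using W_pos by simp
  have "i mod W < N" "j < d \<Longrightarrow> (d+j)*W + i mod W < N" for j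
    using pair_index_less[of 0 "2*d*d" "i mod W" W] pair_index_less[of "d + j" "2*d*d" "i mod W" W]
      level_index_less[of j d] w d_pos by simp_all
  then have "walsh_sum d (overlap \<beta> h (i mod W)) X = v $ (i mod W)
      - (\<Sum>j<d. cnj (phase_state d \<beta> X $ j) * v $ ((d+j)*W + i mod W))"
    by (simp add: walsh_sum_overlap coeffs)
  then show ?thesis
    unfolding query_op_reflection_oracle[OF d_pos phase_state_carrier q v i]
    using i coeffs by (simp add: query_coeffs_def[abs_def] walsh_sum_diff walsh_sum_spread)
qed

lemma degree_le_overlap:
  assumes "degree_le K h"
  shows "degree_le (Suc K) (overlap \<beta> h)"
  unfolding degree_le_def
proof (intro allI impI)
  fix w and S :: "nat set"
  assume S: "Suc K < card S"
  then have "K < card (toggle S j)" for j using card_toggle[of S j] by linarith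
  then show "overlap \<beta> h w S = 0" using assms S by (simp add: overlap_def degree_le_def)
qed

lemma degree_le_query_coeffs:
  assumes "degree_le K h"
  shows "degree_le (K + 2) (query_coeffs \<beta> h)"
  unfolding degree_le_def
proof (intro allI impI)
  fix i and S :: "nat set"
  assume S: "K + 2 < card S"
  then have "Suc K < card (toggle S j)" for j using card_toggle[of S j] by linarith
  then show "query_coeffs \<beta> h i S = 0"
    using assms S degree_le_overlap[OF assms]
    by (simp add: query_coeffs_def spread_def degree_le_def)
qed

lemma coeff_norm_spread:
  assumes unimodular: "\<And>j. cmod (\<beta> j) = 1"
  shows "coeff_norm d {..<N} (spread \<beta> f) \<le> sqrt 2 * coeff_norm d {..<W} f"
proof (rule coeff_norm_leI)
  have level: "mass d (spread \<beta> f ((d+j)*W + w)) = mass d (f w) / d" if "j < d" "w < W" for j w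
  proof -
    have "mass d (spread \<beta> f ((d+j)*W + w)) = mass d (\<lambda>S. f w (toggle S j)) / d"
      unfolding mass_def sum_divide_distrib using that
      by (intro sum.cong) (simp_all add: spread_level norm_mult norm_divide unimodular power_divide)
    then show ?thesis using that by (simp add: mass_toggle)
  qed
  have "(\<Sum>i<N. mass d (spread \<beta> f i))
      = (\<Sum>w<W. mass d (spread \<beta> f w) + (\<Sum>j<d. mass d (spread \<beta> f ((d+j)*W + w))))"
    by (rule sum_mass_levels) (rule spread_off_levels)
  also have "\<dots> = (\<Sum>w<W. 2 * mass d (f w))"
    using d_pos by (intro sum.cong refl) (simp add: spread_low level)
  finally show "(\<Sum>i<N. mass d (spread \<beta> f i)) \<le> 2 * (\<Sum>w<W. mass d (f w))"
    by (simp add: sum_distrib_left)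
qed simp

lemma coeff_norm_overlap:
  assumes unimodular: "\<And>j. cmod (\<beta> j) = 1"
  shows "coeff_norm d {..<W} (overlap \<beta> h) \<le> sqrt 2 * coeff_norm d {..<N} h"
proof (rule coeff_norm_leI)
  let ?level = "\<lambda>w j. h ((d+j)*W + w)"
  have "(cmod (overlap \<beta> h w S))\<^sup>2
      \<le> 2 * ((cmod (h w S))\<^sup>2 + (\<Sum>j<d. (cmod (?level w j (toggle S j)))\<^sup>2))"
    for w and S :: "nat set"
  proof -
    have "(cmod (\<Sum>j<d. cnj (\<beta> j) / sqrt d * ?level w j (toggle S j)))\<^sup>2
        \<le> (\<Sum>j<d. (cmod (cnj (\<beta> j) / sqrt d))\<^sup>2) * (\<Sum>j<d. (cmod (?level w j (toggle S j)))\<^sup>2)"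
      by (rule norm_sum_mult_square_le)
    also have "(\<Sum>j<d. (cmod (cnj (\<beta> j) / sqrt d))\<^sup>2) = 1"
      using d_pos by (simp add: norm_divide unimodular power_divide)
    finally show ?thesis
      unfolding overlap_def by (intro order_trans[OF norm_diff_square_le]) simp
  qed
  then have "mass d (overlap \<beta> h w) \<le> 2 * (mass d (h w) + (\<Sum>j<d. mass d (?level w j)))" for w
    unfolding sum_toggle_square[symmetric]
    unfolding mass_def sum.distrib[symmetric] sum_distrib_left[of 2] by (rule sum_mono)
  then have "(\<Sum>w<W. mass d (overlap \<beta> h w))
      \<le> 2 * (\<Sum>w<W. mass d (h w) + (\<Sum>j<d. mass d (?level w j)))"
    unfolding sum_distrib_left[of 2] by (rule sum_mono)
  also have "\<dots> \<le> 2 * (\<Sum>i<N. mass d (h i))"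
    using sum_levels_le[of "\<lambda>i. mass d (h i)"] by (simp add: mass_nonneg)
  finally show "(\<Sum>w<W. mass d (overlap \<beta> h w)) \<le> 2 * (\<Sum>i<N. mass d (h i))" .
qed simp

lemma coeff_norm_query_coeffs:
  assumes unimodular: "\<And>j. cmod (\<beta> j) = 1"
  shows "coeff_norm d {..<N} (query_coeffs \<beta> h) = coeff_norm d {..<N} h"
proof (rule coeff_norm_pointwise_unitary)
  let ?Q = "\<lambda>X. query_op QU (phase_oracle d \<beta> X) W"
  fix X
  have "is_unitary (2*d*d) (phase_oracle d \<beta> X)"
    using state_prep_reflection_oracle[OF d_pos is_pure_state_phase_state[OF d_pos unimodular]]
    by (simp add: state_prep_def)
  then show "is_unitary N (?Q X)" by (simp add: query_op_def is_unitary_kron is_unitary_one)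
  fix i assume i: "i < N"
  have "walsh_sum d (query_coeffs \<beta> h i) X = (?Q X *\<^sub>v vec N (\<lambda>k. walsh_sum d (h k) X)) $ i"
    by (rule query_op_phase_state[symmetric]) (use i in auto)
  also have "\<dots> = (\<Sum>k<N. ?Q X $$ (i,k) * walsh_sum d (h k) X)"
    using i index_mult_mat_vec_sum[OF query_op_carrier vec_carrier i]
    by (simp add: reflection_oracle_carrier phase_state_carrier)
  finally show "walsh_sum d (query_coeffs \<beta> h i) X = (\<Sum>k<N. ?Q X $$ (i,k) * walsh_sum d (h k) X)" .
qed

context
  fixes \<beta> :: "nat \<Rightarrow> complex"
  assumes unimodular: "\<And>j. cmod (\<beta> j) = 1"
begin

lemma removing_transition_error:
  assumes "finite S"
  shows "(cmod (prod \<beta> S - cnj (\<beta> j) * prod \<beta> (toggle S j)))\<^sup>2 \<le> (if j \<in> S then 4 else 0)"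
proof (cases "j \<in> S")
  case True
  then show ?thesis
    using norm_diff_square_le[of "prod \<beta> S" "cnj (\<beta> j) * prod \<beta> (toggle S j)"]
    by (simp add: norm_mult cmod_prod_unimodular unimodular)
next
  case False
  have "cnj (\<beta> j) * \<beta> j = 1"
    using unimodular by (simp add: complex_norm_square[symmetric] mult.commute)
  then show ?thesis using False assms by (simp add: prod_toggle(2) mult.assoc[symmetric])
qed

lemma adding_transition_error:
  assumes "finite S"
  shows "(cmod (prod \<beta> S - \<beta> j * prod \<beta> (toggle S j)))\<^sup>2 \<le> (if j \<in> S then 0 else 4)"
proof (cases "j \<in> S")
  case True
  then show ?thesis using assms by (simp add: prod_toggle(1))
next
  case False
  then show ?thesis
    using norm_diff_square_le[of "prod \<beta> S" "\<beta> j * prod \<beta> (toggle S j)"]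
    by (simp add: norm_mult cmod_prod_unimodular unimodular)
qed

lemma cmod_twist_error_overlap:
  assumes degree: "degree_le K h" and S: "S \<subseteq> {..<d}"
  shows "(cmod (twist_error overlap \<beta> h w S))\<^sup>2
    \<le> 4 * real (Suc K) / d * (\<Sum>j<d. (cmod (h ((d+j)*W + w) (toggle S j)))\<^sup>2)"
    (is "(cmod ?E)\<^sup>2 \<le> _ * ?R")
proof (cases "Suc K < card S")
  case True
  then have "K < card S" "K < card (toggle S j)" for j using card_toggle[of S j] by linarith+
  then show ?thesis using degree by (simp add: twist_error_def overlap_def twist_def degree_le_def)
next
  case False
  define weight where "weight j = (prod \<beta> S - cnj (\<beta> j) * prod \<beta> (toggle S j)) / sqrt d" for j
  have fin: "finite S" using S finite_subset by auto
  have "(cmod (weight j))\<^sup>2 \<le> (if j \<in> S then 4 / d else 0)" for j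
    using removing_transition_error[OF fin, of j]
    by (auto simp: weight_def norm_divide power_divide divide_right_mono split: if_splits)
  then have "(\<Sum>j<d. (cmod (weight j))\<^sup>2) \<le> (\<Sum>j<d. if j \<in> S then 4 / d else 0)" by (rule sum_mono)
  also have "\<dots> = card S * (4 / d)"
    using S by (simp add: sum.inter_restrict[symmetric] Int_absorb1)
  also have "\<dots> \<le> 4 * real (Suc K) / d" using False by (simp add: divide_right_mono)
  finally have sum_weights: "(\<Sum>j<d. (cmod (weight j))\<^sup>2) \<le> 4 * real (Suc K) / d" .
  have "?E = (\<Sum>j<d. weight j * h ((d+j)*W + w) (toggle S j))"
    by (simp add: twist_error_def overlap_def twist_def weight_def right_diff_distrib
        left_diff_distrib diff_divide_distrib sum_subtractf sum_distrib_left mult_ac)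
  then have "(cmod ?E)\<^sup>2 \<le> (\<Sum>j<d. (cmod (weight j))\<^sup>2) * ?R"
    by (simp only: norm_sum_mult_square_le)
  also have "\<dots> \<le> 4 * real (Suc K) / d * ?R"
    by (intro mult_right_mono sum_weights sum_nonneg) simp
  finally show ?thesis .
qed

lemma coeff_norm_twist_error_overlap:
  assumes degree: "degree_le K h"
  shows "coeff_norm d {..<W} (twist_error overlap \<beta> h)
    \<le> sqrt (4 * real (Suc K) / d) * coeff_norm d {..<N} h"
    (is "coeff_norm d _ ?E \<le> sqrt ?bound * _")
proof (rule coeff_norm_leI)
  let ?level = "\<lambda>w j. h ((d+j)*W + w)"
  have "mass d (?E w) \<le> ?bound * (mass d (h w) + (\<Sum>j<d. mass d (?level w j)))" for w
  proof -
    have "mass d (?E w) \<le> ?bound * (\<Sum>j<d. mass d (?level w j))"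
      unfolding sum_toggle_square[symmetric]
      unfolding mass_def
      by (subst sum_distrib_left) (intro sum_mono cmod_twist_error_overlap degree; simp)
    also have "\<dots> \<le> ?bound * (mass d (h w) + (\<Sum>j<d. mass d (?level w j)))"
      by (intro mult_left_mono) (simp_all add: mass_nonneg)
    finally show ?thesis .
  qed
  then have "(\<Sum>w<W. mass d (?E w)) \<le> ?bound * (\<Sum>w<W. mass d (h w) + (\<Sum>j<d. mass d (?level w j)))"
    unfolding sum_distrib_left[of ?bound] by (rule sum_mono)
  also have "\<dots> \<le> ?bound * (\<Sum>i<N. mass d (h i))"
    by (intro mult_left_mono sum_levels_le) (simp_all add: mass_nonneg)
  finally show "(\<Sum>w<W. mass d (?E w)) \<le> ?bound * (\<Sum>i<N. mass d (h i))" .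
qed simp

lemma mass_twist_error_spread_level:
  assumes "j < d" "w < W"
  shows "mass d (twist_error spread \<beta> f ((d+j)*W + w))
    \<le> (\<Sum>S\<in>Pow {..<d}. if j \<in> S then 4 / d * (cmod (f w S))\<^sup>2 else 0)"
    (is "mass d ?E \<le> (\<Sum>S\<in>_. ?b S)")
proof -
  have "(cmod (?E S))\<^sup>2 \<le> ?b (toggle S j)" if "S \<in> Pow {..<d}" for S
  proof -
    have "finite S" using that finite_subset by auto
    note adding_transition_error[OF this, of j]
    moreover have "?E S = (prod \<beta> S - \<beta> j * prod \<beta> (toggle S j)) / sqrt d * f w (toggle S j)"
      unfolding twist_error_def spread_level[OF assms] twist_def
      by (simp add: algebra_simps diff_divide_distrib)
    ultimately show ?thesis
      by (auto simp: norm_mult norm_divide power_mult_distrib power_divide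
          intro!: mult_right_mono divide_right_mono)
  qed
  then have "mass d ?E \<le> (\<Sum>S\<in>Pow {..<d}. ?b (toggle S j))"
    unfolding mass_def by (rule sum_mono)
  then show ?thesis using sum_Pow_toggle[OF assms(1), of ?b] by simp
qed

lemma sum_mass_twist_error_spread_levels:
  assumes degree: "degree_le K f" and w: "w < W"
  shows "(\<Sum>j<d. mass d (twist_error spread \<beta> f ((d+j)*W + w))) \<le> 4 * real K / d * mass d (f w)"
proof -
  let ?b = "\<lambda>S. 4 / d * (cmod (f w S))\<^sup>2"
  have "(\<Sum>j<d. if j \<in> S then ?b S else 0) \<le> 4 * real K / d * (cmod (f w S))\<^sup>2"
    if "S \<in> Pow {..<d}" for S
  proof -
    have "(\<Sum>j<d. if j \<in> S then ?b S else 0) = card S * ?b S"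
      using that by (simp add: sum.inter_restrict[symmetric] Int_absorb1)
    also have "\<dots> \<le> real K * ?b S"
    proof (cases "K < card S")
      case True
      then show ?thesis using degree by (simp add: degree_le_def)
    qed (intro mult_right_mono; simp)
    finally show ?thesis by (simp add: mult_ac)
  qed
  then have sum_b: "(\<Sum>j<d. \<Sum>S\<in>Pow {..<d}. if j \<in> S then ?b S else 0)
      \<le> 4 * real K / d * mass d (f w)"
    unfolding mass_def sum_distrib_left by (subst sum.swap) (rule sum_mono)
  show ?thesis
    by (rule order_trans[OF sum_mono sum_b]) (rule mass_twist_error_spread_level, use w in auto)
qed

lemma coeff_norm_twist_error_spread:
  assumes degree: "degree_le K f"
  shows "coeff_norm d {..<N} (twist_error spread \<beta> f)
    \<le> sqrt (4 * real K / d) * coeff_norm d {..<W} f"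
    (is "coeff_norm d _ ?E \<le> _")
proof (rule coeff_norm_leI)
  have low: "mass d (?E w) = 0" if "w < W" for w
    using that by (simp add: twist_error_def spread_low twist_def mass_def)
  have "(\<Sum>i<N. mass d (?E i)) = (\<Sum>w<W. mass d (?E w) + (\<Sum>j<d. mass d (?E ((d+j)*W + w))))"
    by (rule sum_mass_levels) (simp add: twist_error_def[abs_def] spread_off_levels twist_def)
  also have "\<dots> \<le> (\<Sum>w<W. 4 * real K / d * mass d (f w))"
    using sum_mass_twist_error_spread_levels[OF degree] by (intro sum_mono) (simp add: low)
  finally show "(\<Sum>i<N. mass d (?E i)) \<le> 4 * real K / d * (\<Sum>w<W. mass d (f w))"
    by (simp add: sum_distrib_left)
qed simp

lemma coeff_norm_twist_error_query_coeffs: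
  assumes degree: "degree_le K h"
  shows "coeff_norm d {..<N} (twist_error query_coeffs \<beta> h)
    \<le> sqrt (32 * real (Suc K) / d) * coeff_norm d {..<N} h"
proof -
  let ?\<epsilon> = "sqrt (4 * real (Suc K) / d)"
  let ?E = "twist_error overlap \<beta> h" and ?F = "twist_error spread \<beta> (overlap (\<lambda>_. 1) h)"
  have decomposition: "twist_error query_coeffs \<beta> h = (\<lambda>i S. 0 - (spread \<beta> ?E i S + ?F i S))"
    by (intro ext) (simp add: twist_error_def[abs_def] query_coeffs_def spread_diff
        twist_def[of _ "query_coeffs _ _"] twist_def[of _ h] twist_def[of _ "spread _ _"]
        algebra_simps)
  have "coeff_norm d {..<N} (twist_error query_coeffs \<beta> h)
      = coeff_norm d {..<N} (\<lambda>i S. spread \<beta> ?E i S + ?F i S)"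
    by (subst decomposition, subst coeff_norm_minus_commute) simp
  also have "\<dots> \<le> coeff_norm d {..<N} (spread \<beta> ?E) + coeff_norm d {..<N} ?F"
    by (rule coeff_norm_triangle)
  also have "coeff_norm d {..<N} (spread \<beta> ?E) \<le> sqrt 2 * (?\<epsilon> * coeff_norm d {..<N} h)"
    using coeff_norm_spread[OF unimodular, where f = ?E] coeff_norm_twist_error_overlap[OF degree]
    by (rule order_trans[OF _ mult_left_mono]) simp
  also have "coeff_norm d {..<N} ?F \<le> ?\<epsilon> * (sqrt 2 * coeff_norm d {..<N} h)"
    using coeff_norm_twist_error_spread[OF degree_le_overlap[OF degree]] coeff_norm_overlap
    by (rule order_trans[OF _ mult_left_mono]) simp_all
  also have "sqrt 2 * (?\<epsilon> * coeff_norm d {..<N} h) + ?\<epsilon> * (sqrt 2 * coeff_norm d {..<N} h)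
      = sqrt (32 * real (Suc K) / d) * coeff_norm d {..<N} h"
  proof -
    have "sqrt (32 * real (Suc K) / d) = sqrt (4 * (2 * (4 * real (Suc K) / d)))" by simp
    also have "\<dots> = 2 * (sqrt 2 * ?\<epsilon>)" unfolding real_sqrt_mult by simp
    finally show ?thesis by (simp add: algebra_simps)
  qed
  finally show ?thesis by simp
qed

end

end

section \<open>The query lower bound\<close>

lemma final_state_snoc:
  "final_state d W V0 (steps @ [(q,V)]) U = V *\<^sub>v (query_op q U W *\<^sub>v final_state d W V0 steps U)"
  by (simp add: final_state_def)

definition mean_accept :: "nat \<Rightarrow> nat \<Rightarrow> complex mat \<Rightarrow> (query \<times> complex mat) list \<Rightarrow> nat set
    \<Rightarrow> (nat \<Rightarrow> complex) \<Rightarrow> real" where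
  "mean_accept d W V0 steps Acc \<beta> = (\<Sum>X\<in>Pow {..<d}.
     accept_prob (2*d*d*W) Acc (final_state d W V0 steps (phase_oracle d \<beta> X))) / 2 ^ d"

context query_layout
begin

definition evolve_coeffs ::
  "(nat \<Rightarrow> complex) \<Rightarrow> complex mat \<Rightarrow> (query \<times> complex mat) list \<Rightarrow> coefficients" where
  "evolve_coeffs \<beta> V0 steps = foldl (\<lambda>h (q,V). mat_apply N V (query_coeffs \<beta> h))
     (\<lambda>i S. if S = {} then (V0 *\<^sub>v unit_vec N 0) $ i else 0) steps"

lemma evolve_coeffs_Nil:
  "evolve_coeffs \<beta> V0 [] = (\<lambda>i S. if S = {} then (V0 *\<^sub>v unit_vec N 0) $ i else 0)"
  by (simp add: evolve_coeffs_def)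

lemma evolve_coeffs_snoc:
  "evolve_coeffs \<beta> V0 (steps @ [(q,V)]) = mat_apply N V (query_coeffs \<beta> (evolve_coeffs \<beta> V0 steps))"
  by (simp add: evolve_coeffs_def)

lemma final_state_evolve_coeffs:
  assumes "is_alg d W V0 steps" "fst ` set steps \<subseteq> {QU, QUdag}"
  shows "final_state d W V0 steps (phase_oracle d \<beta> X) \<in> carrier_vec N \<and>
    (\<forall>i<N. final_state d W V0 steps (phase_oracle d \<beta> X) $ i
      = walsh_sum d (evolve_coeffs \<beta> V0 steps i) X)"
  using assms
proof (induction steps rule: rev_induct)
  case Nil
  then have "V0 \<in> carrier_mat N N" by (simp add: is_alg_def is_unitary_def)
  then show ?case by (simp add: final_state_def evolve_coeffs_Nil walsh_sum_empty)
next
  case (snoc s steps)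
  obtain q V where s: "s = (q,V)" by (cases s)
  let ?U = "phase_oracle d \<beta> X"
  let ?v = "final_state d W V0 steps ?U"
  have v: "?v \<in> carrier_vec N" "\<And>i. i < N \<Longrightarrow> ?v $ i = walsh_sum d (evolve_coeffs \<beta> V0 steps i) X"
    using snoc by (auto simp: is_alg_def)
  have V: "V \<in> carrier_mat N N" and q: "q \<in> {QU,QUdag}"
    using snoc.prems by (auto simp: s is_alg_def is_unitary_def)
  have Qv: "query_op q ?U W *\<^sub>v ?v \<in> carrier_vec N"
    by (intro mult_mat_vec_carrier[OF query_op_carrier v(1)] reflection_oracle_carrier
        phase_state_carrier)
  have "(V *\<^sub>v (query_op q ?U W *\<^sub>v ?v)) $ i = walsh_sum d (evolve_coeffs \<beta> V0 (steps @ [s]) i) X"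
    if i: "i < N" for i
  proof -
    have "(V *\<^sub>v (query_op q ?U W *\<^sub>v ?v)) $ i
        = (\<Sum>k<N. V $$ (i,k) * walsh_sum d (query_coeffs \<beta> (evolve_coeffs \<beta> V0 steps) k) X)"
      unfolding index_mult_mat_vec_sum[OF V Qv i]
      by (intro sum.cong refl arg_cong2[where f = "(*)"] query_op_phase_state[OF q _ v]) auto
    then show ?thesis
      by (simp add: s evolve_coeffs_snoc mat_apply_def[abs_def] walsh_sum_sum walsh_sum_cmult)
  qed
  then show ?case using V Qv by (simp add: s final_state_snoc)
qed

lemma coeff_norm_evolve_coeffs:
  assumes unimodular: "\<And>j. cmod (\<beta> j) = 1" and alg: "is_alg d W V0 steps"
  shows "coeff_norm d {..<N} (evolve_coeffs \<beta> V0 steps) = 1"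
  using alg
proof (induction steps rule: rev_induct)
  case Nil
  let ?v = "V0 *\<^sub>v unit_vec N 0"
  have "is_pure_state N ?v"
    using Nil d_pos W_pos
    by (intro is_pure_state_unitary is_pure_state_unit_vec) (auto simp: is_alg_def)
  moreover have "mass d (\<lambda>S. if S = {} then c else 0) = (cmod c)\<^sup>2" for c
    by (simp add: mass_def if_distrib[of cmod] if_distrib[of "\<lambda>x. x\<^sup>2"] cong: if_cong)
  ultimately have "(coeff_norm d {..<N} (evolve_coeffs \<beta> V0 []))\<^sup>2 = 1"
    by (simp add: coeff_norm_square evolve_coeffs_Nil is_pure_state_def)
  then show ?case
    using coeff_norm_nonneg[of d "{..<N}" "evolve_coeffs \<beta> V0 []"] by (auto simp: power2_eq_1_iff)
next
  case (snoc s steps)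
  then show ?case
    by (cases s) (simp add: evolve_coeffs_snoc is_alg_def coeff_norm_mat_apply
        coeff_norm_query_coeffs[OF unimodular])
qed

lemma degree_le_evolve_coeffs: "degree_le (2 * length steps) (evolve_coeffs \<beta> V0 steps)"
proof (induction steps rule: rev_induct)
  case Nil
  then show ?case by (auto simp: evolve_coeffs_Nil degree_le_def)
next
  case (snoc s steps)
  have "degree_le (2 * length (steps @ [s])) (query_coeffs \<beta> (evolve_coeffs \<beta> V0 steps))"
    using degree_le_query_coeffs[OF snoc] by simp
  then show ?case by (cases s) (simp add: evolve_coeffs_snoc degree_le_def mat_apply_def)
qed

lemma coeff_norm_step_twist_le:
  assumes unimodular: "\<And>j. cmod (\<beta> j) = 1" and V: "is_unitary N V" and degree: "degree_le K g"
  shows "coeff_norm d {..<N} (\<lambda>i S. mat_apply N V (query_coeffs \<beta> f) i S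
      - twist \<beta> (mat_apply N V (query_coeffs (\<lambda>_. 1) g)) i S)
    \<le> coeff_norm d {..<N} (\<lambda>i S. f i S - twist \<beta> g i S)
      + sqrt (32 * real (Suc K) / d) * coeff_norm d {..<N} g"
proof -
  let ?old = "\<lambda>i S. f i S - twist \<beta> g i S"
  let ?new = "twist_error query_coeffs \<beta> g"
  have "(\<lambda>i S. mat_apply N V (query_coeffs \<beta> f) i S
        - twist \<beta> (mat_apply N V (query_coeffs (\<lambda>_. 1) g)) i S)
      = mat_apply N V (\<lambda>i S. query_coeffs \<beta> ?old i S + ?new i S)"
    by (intro ext) (simp add: mat_apply_def query_coeffs_diff twist_error_def
        twist_def[of _ "mat_apply _ _ _"] twist_def[of _ "query_coeffs _ _"]
        right_diff_distrib sum_subtractf sum_distrib_left mult_ac)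
  then have "coeff_norm d {..<N} (\<lambda>i S. mat_apply N V (query_coeffs \<beta> f) i S
        - twist \<beta> (mat_apply N V (query_coeffs (\<lambda>_. 1) g)) i S)
      = coeff_norm d {..<N} (\<lambda>i S. query_coeffs \<beta> ?old i S + ?new i S)"
    by (simp only: coeff_norm_mat_apply[OF V])
  also have "\<dots> \<le> coeff_norm d {..<N} (query_coeffs \<beta> ?old) + coeff_norm d {..<N} ?new"
    by (rule coeff_norm_triangle)
  also have "coeff_norm d {..<N} (query_coeffs \<beta> ?old) = coeff_norm d {..<N} ?old"
    by (rule coeff_norm_query_coeffs[OF unimodular])
  also have "coeff_norm d {..<N} ?new \<le> sqrt (32 * real (Suc K) / d) * coeff_norm d {..<N} g"
    by (rule coeff_norm_twist_error_query_coeffs[OF unimodular degree])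
  finally show ?thesis by simp
qed

lemma coeff_norm_evolve_coeffs_twist:
  assumes unimodular: "\<And>j. cmod (\<beta> j) = 1" and alg: "is_alg d W V0 steps" "length steps \<le> t"
  shows "coeff_norm d {..<N}
      (\<lambda>i S. evolve_coeffs \<beta> V0 steps i S - twist \<beta> (evolve_coeffs (\<lambda>_. 1) V0 steps) i S)
    \<le> length steps * sqrt (64 * real t / d)"
  using alg
proof (induction steps rule: rev_induct)
  case Nil
  have "(\<lambda>i S. evolve_coeffs \<beta> V0 [] i S - twist \<beta> (evolve_coeffs (\<lambda>_. 1) V0 []) i S) = (\<lambda>i S. 0)"
    by (intro ext) (simp add: evolve_coeffs_Nil twist_def)
  then show ?case by (simp add: coeff_norm_def L2_set_0')
next
  case (snoc s steps)
  obtain q V where s: "s = (q,V)" by (cases s)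
  let ?f = "evolve_coeffs \<beta> V0 steps" and ?g = "evolve_coeffs (\<lambda>_. 1) V0 steps"
  have V: "is_unitary N V" and alg: "is_alg d W V0 steps"
    using snoc.prems(1) by (auto simp: is_alg_def s)
  have "coeff_norm d {..<N} (\<lambda>i S. evolve_coeffs \<beta> V0 (steps @ [s]) i S
        - twist \<beta> (evolve_coeffs (\<lambda>_. 1) V0 (steps @ [s])) i S)
      \<le> coeff_norm d {..<N} (\<lambda>i S. ?f i S - twist \<beta> ?g i S)
        + sqrt (32 * real (Suc (2 * length steps)) / d) * coeff_norm d {..<N} ?g"
    unfolding s evolve_coeffs_snoc
    by (rule coeff_norm_step_twist_le[OF unimodular V degree_le_evolve_coeffs])
  also have "\<dots> = coeff_norm d {..<N} (\<lambda>i S. ?f i S - twist \<beta> ?g i S)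
        + sqrt (32 * real (Suc (2 * length steps)) / d)"
    using coeff_norm_evolve_coeffs[OF _ alg, of "\<lambda>_. 1"] by simp
  also have "\<dots> \<le> length steps * sqrt (64 * real t / d) + sqrt (64 * real t / d)"
    using snoc.IH[OF alg] snoc.prems(2) by (intro add_mono real_sqrt_le_mono divide_right_mono) auto
  also have "\<dots> = length (steps @ [s]) * sqrt (64 * real t / d)" by (simp add: algebra_simps)
  finally show ?case .
qed

lemma mean_accept_eq_coeff_norm:
  assumes "is_alg d W V0 steps" "fst ` set steps \<subseteq> {QU, QUdag}"
  shows "mean_accept d W V0 steps Acc \<beta>
    = (coeff_norm d {i. i < N \<and> i \<in> Acc} (evolve_coeffs \<beta> V0 steps))\<^sup>2"
proof -
  have "(\<Sum>X\<in>Pow {..<d}. accept_prob N Acc (final_state d W V0 steps (phase_oracle d \<beta> X)))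
      = (\<Sum>X\<in>Pow {..<d}. \<Sum>i | i < N \<and> i \<in> Acc. (cmod (walsh_sum d (evolve_coeffs \<beta> V0 steps i) X))\<^sup>2)"
    unfolding accept_prob_def using final_state_evolve_coeffs[OF assms]
    by (intro sum.cong refl) auto
  then show ?thesis by (simp add: mean_accept_def sum_walsh_sum_square)
qed

lemma sqrt_mean_accept_le:
  assumes unimodular: "\<And>j. cmod (\<beta> j) = 1"
    and alg: "is_alg d W V0 steps" "fst ` set steps \<subseteq> {QU, QUdag}"
  shows "sqrt (mean_accept d W V0 steps Acc (\<lambda>_. 1))
    \<le> sqrt (mean_accept d W V0 steps Acc \<beta>) + length steps * sqrt (64 * real (length steps) / d)"
proof -
  let ?A = "{i. i < N \<and> i \<in> Acc}"
  let ?f = "evolve_coeffs \<beta> V0 steps" and ?g = "twist \<beta> (evolve_coeffs (\<lambda>_. 1) V0 steps)"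
  have "sqrt (mean_accept d W V0 steps Acc (\<lambda>_. 1))
      = coeff_norm d ?A (\<lambda>i S. ?f i S + (?g i S - ?f i S))"
    using coeff_norm_twist[OF unimodular, where h = "evolve_coeffs (\<lambda>_. 1) V0 steps"]
    by (simp add: mean_accept_eq_coeff_norm[OF alg] coeff_norm_nonneg)
  also have "\<dots> \<le> coeff_norm d ?A ?f + coeff_norm d ?A (\<lambda>i S. ?g i S - ?f i S)"
    by (rule coeff_norm_triangle)
  also have "coeff_norm d ?A ?f = sqrt (mean_accept d W V0 steps Acc \<beta>)"
    by (simp add: mean_accept_eq_coeff_norm[OF alg] coeff_norm_nonneg)
  also have "coeff_norm d ?A (\<lambda>i S. ?g i S - ?f i S) \<le> coeff_norm d {..<N} (\<lambda>i S. ?f i S - ?g i S)"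
    by (subst coeff_norm_minus_commute) (intro coeff_norm_mono; auto)
  also have "\<dots> \<le> length steps * sqrt (64 * real (length steps) / d)"
    by (rule coeff_norm_evolve_coeffs_twist[OF unimodular alg(1) order_refl])
  finally show ?thesis by simp
qed

end

lemma
  assumes sol: "solves_reality d Q W V0 steps Acc" and d_pos: "0 < d"
    and unimodular: "\<And>j. cmod (\<beta> j) = 1"
  shows mean_accept_ge: "cmod (\<Sum>j<d. (\<beta> j)\<^sup>2) = d \<Longrightarrow> 2/3 \<le> mean_accept d W V0 steps Acc \<beta>"
    and mean_accept_le: "(\<Sum>j<d. (\<beta> j)\<^sup>2) = 0 \<Longrightarrow> mean_accept d W V0 steps Acc \<beta> \<le> 1/3"
proof -
  let ?p = "\<lambda>X. accept_prob (2*d*d*W) Acc (final_state d W V0 steps (phase_oracle d \<beta> X))"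
  have state: "is_pure_state d (phase_state d \<beta> X)"
      "state_prep d (phase_state d \<beta> X) (phase_oracle d \<beta> X)" for X
    using is_pure_state_phase_state[OF d_pos unimodular] state_prep_reflection_oracle[OF d_pos]
    by auto
  show "2/3 \<le> mean_accept d W V0 steps Acc \<beta>" if "cmod (\<Sum>j<d. (\<beta> j)\<^sup>2) = d"
  proof -
    have "realness d (phase_state d \<beta> X) = 1" for X
      using that d_pos by (simp add: realness_phase_state)
    then have "2/3 \<le> ?p X" for X using sol state unfolding solves_reality_def by blast
    then have "(\<Sum>X\<in>Pow {..<d}. 2/3) \<le> (\<Sum>X\<in>Pow {..<d}. ?p X)" by (intro sum_mono)
    then show ?thesis by (simp add: mean_accept_def card_Pow field_simps)
  qed
  show "mean_accept d W V0 steps Acc \<beta> \<le> 1/3" if "(\<Sum>j<d. (\<beta> j)\<^sup>2) = 0"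
  proof -
    have "realness d (phase_state d \<beta> X) < 1/10" for X
      using that d_pos by (simp add: realness_phase_state)
    then have "?p X \<le> 1/3" for X using sol state unfolding solves_reality_def by blast
    then have "(\<Sum>X\<in>Pow {..<d}. ?p X) \<le> (\<Sum>X\<in>Pow {..<d}. 1/3)" by (intro sum_mono)
    then show ?thesis by (simp add: mean_accept_def card_Pow field_simps)
  qed
qed

lemma sum_half_turn_squares:
  assumes "1 < d"
  shows "(\<Sum>j<d. (cis (pi * real j / real d))\<^sup>2) = 0"
proof -
  have "(\<Sum>j<d. (cis (pi * real j / real d))\<^sup>2) = (\<Sum>j<d. cis (2 * pi * real j / real d))"
    by (simp add: DeMoivre mult_ac)
  also have "\<dots> = \<Sum>{z. z ^ d = 1}"
    using assms by (intro sum.reindex_bij_betw bij_betw_roots_unity) simp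
  finally show ?thesis using sum_roots_unity[OF assms] by simp
qed

lemma reality_query_lower_bound:
  assumes d: "1 < d" and sol: "solves_reality d {QU, QUdag} W V0 steps Acc"
  shows "1/12 * real d powr (1/3) \<le> length steps"
proof -
  let ?t = "real (length steps)"
  let ?\<beta> = "\<lambda>j. cis (pi * real j / real d)" and ?p = "mean_accept d W V0 steps Acc"
  define \<epsilon> where "\<epsilon> = ?t * sqrt (64 * ?t / d)"
  have alg: "is_alg d W V0 steps" "fst ` set steps \<subseteq> {QU, QUdag}"
    using sol by (auto simp: solves_reality_def)
  then interpret query_layout d W using d by unfold_locales (auto simp: is_alg_def)
  have "sqrt (2/3) \<le> sqrt (?p (\<lambda>_. 1))"
    using mean_accept_ge[OF sol d_pos, of "\<lambda>_. 1"] by simp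
  also have "\<dots> \<le> sqrt (?p ?\<beta>) + \<epsilon>"
    unfolding \<epsilon>_def by (rule sqrt_mean_accept_le[OF _ alg]) simp
  also have "sqrt (?p ?\<beta>) \<le> sqrt (1/3)"
    using mean_accept_le[OF sol d_pos, of ?\<beta>] sum_half_turn_squares[OF d] by simp
  finally have gap: "sqrt (2/3) - sqrt (1/3) \<le> \<epsilon>" by simp
  have "4/5 \<le> sqrt (2/3)" by (rule real_le_rsqrt) (simp add: power2_eq_square)
  moreover have "sqrt (1/3) \<le> 3/5" by (rule real_le_lsqrt) (simp_all add: power2_eq_square)
  ultimately have "(1/5)\<^sup>2 \<le> \<epsilon>\<^sup>2" using gap by (intro power_mono) auto
  also have "\<epsilon>\<^sup>2 = ?t\<^sup>2 * (64 * ?t / d)" by (simp add: \<epsilon>_def power_mult_distrib)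
  also have "\<dots> = 64 * ?t ^ 3 / d" by (simp add: power2_eq_square power3_eq_cube)
  finally have "d \<le> (12 * ?t) ^ 3" using d by (simp add: field_simps power2_eq_square)
  then have "(real d powr (1/3)) ^ 3 \<le> (12 * ?t) ^ 3" using d by (simp add: powr_power)
  then have "real d powr (1/3) \<le> 12 * ?t" by (subst (asm) power_mono_iff) auto
  then show ?thesis by simp
qed

section \<open>The swap test\<close>

definition perm_mat :: "nat \<Rightarrow> (nat \<Rightarrow> nat) \<Rightarrow> complex mat" where
  "perm_mat N \<sigma> = mat N N (\<lambda>(i,j). if j = \<sigma> i then 1 else 0)"

lemma perm_mat_carrier: "perm_mat N \<sigma> \<in> carrier_mat N N"
  by (simp add: perm_mat_def)

lemma is_unitary_perm_mat:
  assumes inj: "inj_on \<sigma> {..<N}" and range: "\<And>i. i < N \<Longrightarrow> \<sigma> i < N"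
  shows "is_unitary N (perm_mat N \<sigma>)"
proof (rule is_unitary_rowsI[OF perm_mat_carrier])
  fix i j assume ij: "i < N" "j < N"
  have "(\<Sum>k<N. perm_mat N \<sigma> $$ (i,k) * cnj (perm_mat N \<sigma> $$ (j,k)))
      = (\<Sum>k<N. if k = \<sigma> i then (if i = j then 1 else 0) else 0)"
    using ij inj by (intro sum.cong refl) (auto simp: perm_mat_def inj_on_def)
  then show "(\<Sum>k<N. perm_mat N \<sigma> $$ (i,k) * cnj (perm_mat N \<sigma> $$ (j,k))) = (if i = j then 1 else 0)"
    using range[OF ij(1)] by simp
qed

lemma index_perm_mat_mult_vec:
  assumes v: "v \<in> carrier_vec N" and i: "i < N" "\<sigma> i < N"
  shows "(perm_mat N \<sigma> *\<^sub>v v) $ i = v $ \<sigma> i"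
proof -
  have "(perm_mat N \<sigma> *\<^sub>v v) $ i = (\<Sum>k<N. if k = \<sigma> i then v $ \<sigma> i else 0)"
    unfolding index_mult_mat_vec_sum[OF perm_mat_carrier v i(1)]
    using i by (intro sum.cong refl) (auto simp: perm_mat_def)
  then show ?thesis using i by simp
qed

definition exchange_index :: "nat \<Rightarrow> nat \<Rightarrow> nat \<Rightarrow> nat" where
  "exchange_index n m i = (i mod n) * m + i div n"

definition exchange_mat :: "nat \<Rightarrow> nat \<Rightarrow> complex mat" where
  "exchange_mat n m = perm_mat (n*m) (exchange_index n m)"

lemma exchange_index_pair: "a < n \<Longrightarrow> exchange_index n m (b*n+a) = a*m+b"
  by (simp add: exchange_index_def)

lemma
  assumes "i < n*m"
  shows exchange_index_less: "exchange_index n m i < n*m"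
    and exchange_index_inverse: "exchange_index m n (exchange_index n m i) = i"
proof -
  have "i < m*n" using assms by (simp add: mult.commute)
  then obtain b a where "b < m" "a < n" "i = b*n+a" by (rule pair_index_cases)
  then show "exchange_index n m i < n*m" "exchange_index m n (exchange_index n m i) = i"
    by (simp_all add: exchange_index_pair pair_index_less)
qed

lemma is_unitary_exchange_mat: "is_unitary (n*m) (exchange_mat n m)"
  unfolding exchange_mat_def
  by (intro is_unitary_perm_mat inj_on_inverseI[where g = "exchange_index m n"])
    (simp_all add: exchange_index_less exchange_index_inverse)

lemma exchange_mat_mult_vkron:
  assumes x: "x \<in> carrier_vec n" and y: "y \<in> carrier_vec m"
  shows "exchange_mat n m *\<^sub>v vkron x y = vkron y x"
proof (rule eq_vec_pairI[of _ m n])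
  show "exchange_mat n m *\<^sub>v vkron x y \<in> carrier_vec (m*n)"
    by (simp add: exchange_mat_def perm_mat_def mult.commute carrier_vecI)
  show "vkron y x \<in> carrier_vec (m*n)" using y x by (rule vkron_carrier)
  fix b a assume ba: "b < m" "a < n"
  have "b*n+a < n*m" using pair_index_less[OF ba] by (simp add: mult.commute)
  then have "(exchange_mat n m *\<^sub>v vkron x y) $ (b*n+a) = vkron x y $ exchange_index n m (b*n+a)"
    unfolding exchange_mat_def
    by (intro index_perm_mat_mult_vec vkron_carrier x y exchange_index_less)
  then show "(exchange_mat n m *\<^sub>v vkron x y) $ (b*n+a) = vkron y x $ (b*n+a)"
    using ba by (simp add: exchange_index_pair index_vkron[OF x y] index_vkron[OF y x])
qed

text \<open>The change of basis that diagonalises the involution \<open>\<tau>\<close>: for a two-element orbit the smaller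
  index carries the symmetric and the larger one the antisymmetric combination.\<close>

definition symmetrizer :: "nat \<Rightarrow> (nat \<Rightarrow> nat) \<Rightarrow> complex mat" where
  "symmetrizer N \<tau> = mat N N (\<lambda>(i,j). if \<tau> i = i then (if j = i then 1 else 0)
     else if j = i then (if i < \<tau> i then 1 else -1) / sqrt 2
     else if j = \<tau> i then 1 / sqrt 2 else 0)"

lemma symmetrizer_carrier: "symmetrizer N \<tau> \<in> carrier_mat N N"
  by (simp add: symmetrizer_def)

lemma accept_prob_eq_sum: "accept_prob N Acc v = (\<Sum>i<N. if i \<in> Acc then (cmod (v $ i))\<^sup>2 else 0)"
proof -
  have "{i. i < N \<and> i \<in> Acc} = {..<N} \<inter> Acc" by auto
  then show ?thesis by (simp add: accept_prob_def sum.inter_restrict)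
qed

locale involution =
  fixes N :: nat and \<tau> :: "nat \<Rightarrow> nat"
  assumes range: "i < N \<Longrightarrow> \<tau> i < N" and invol: "i < N \<Longrightarrow> \<tau> (\<tau> i) = i"
begin

lemma sum_symmetrizer_row:
  assumes "i < N"
  shows "(\<Sum>k<N. symmetrizer N \<tau> $$ (i,k) * f k) =
    (if \<tau> i = i then f i else ((if i < \<tau> i then f i else - f i) + f (\<tau> i)) / sqrt 2)"
proof (cases "\<tau> i = i")
  case True
  have "(\<Sum>k<N. symmetrizer N \<tau> $$ (i,k) * f k) = (\<Sum>k<N. if k = i then f i else 0)"
    using assms True by (intro sum.cong refl) (auto simp: symmetrizer_def)
  then show ?thesis using assms True by simp
next
  case False
  have "(\<Sum>k<N. symmetrizer N \<tau> $$ (i,k) * f k)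
      = (\<Sum>k<N. (if k = i then (if i < \<tau> i then f i else - f i) / sqrt 2 else 0)
          + (if k = \<tau> i then f (\<tau> i) / sqrt 2 else 0))"
    using assms False by (intro sum.cong refl) (auto simp: symmetrizer_def)
  also have "\<dots> = (if i < \<tau> i then f i else - f i) / sqrt 2 + f (\<tau> i) / sqrt 2"
    unfolding sum.distrib using assms range[OF assms] by simp
  finally show ?thesis using False by (simp add: add_divide_distrib)
qed

lemma is_unitary_symmetrizer: "is_unitary N (symmetrizer N \<tau>)"
proof (rule is_unitary_rowsI[OF symmetrizer_carrier])
  fix i j assume ij: "i < N" "j < N"
  have \<tau>i: "\<tau> i < N" "\<tau> (\<tau> i) = i" using range invol ij by auto
  have transpose: "\<tau> i = j \<longleftrightarrow> i = \<tau> j" using invol ij by metis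
  have sqrt2: "2 / complex_of_real (sqrt 2) = complex_of_real (sqrt 2)"
    by (simp add: divide_eq_eq flip: of_real_mult)
  have entry: "symmetrizer N \<tau> $$ (j,k) = (if \<tau> j = j then (if k = j then 1 else 0)
     else if k = j then (if j < \<tau> j then 1 else -1) / sqrt 2
     else if k = \<tau> j then 1 / sqrt 2 else 0)" if "k < N" for k
    using that ij by (simp add: symmetrizer_def)
  note row = sum_symmetrizer_row[OF ij(1)] entry[OF ij(1)] entry[OF \<tau>i(1)]
  consider (fixed) "\<tau> i = i" | (diagonal) "\<tau> i \<noteq> i" "j = i" | (orbit) "\<tau> i \<noteq> i" "j = \<tau> i"
    | (disjoint) "\<tau> i \<noteq> i" "j \<noteq> i" "j \<noteq> \<tau> i"
    by blast
  then show "(\<Sum>k<N. symmetrizer N \<tau> $$ (i,k) * cnj (symmetrizer N \<tau> $$ (j,k)))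
      = (if i = j then 1 else 0)"
  proof cases
    case fixed
    then have "i \<noteq> \<tau> j" if "i \<noteq> j" using that transpose by metis
    then show ?thesis unfolding row using fixed by (cases "i = j") auto
  next
    case diagonal
    then show ?thesis unfolding row by (simp add: sqrt2)
  next
    case orbit
    then show ?thesis unfolding row using \<tau>i(2) by simp
  next
    case disjoint
    then have "\<tau> i \<noteq> \<tau> j" "i \<noteq> \<tau> j" using transpose invol[OF ij(2)] \<tau>i(2) by metis+
    then show ?thesis unfolding row using disjoint by simp
  qed
qed

lemma sum_involution: "(\<Sum>i<N. f (\<tau> i)) = (\<Sum>i<N. f i)"
  by (rule sum.reindex_bij_witness[where i = \<tau> and j = \<tau>]) (auto simp: range invol)

lemma accept_prob_symmetrizer:
  assumes p: "is_pure_state N p"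
  shows "accept_prob N {i. i \<le> \<tau> i} (symmetrizer N \<tau> *\<^sub>v p)
    = (1 + Re (p \<bullet>c (perm_mat N \<tau> *\<^sub>v p))) / 2"
proof -
  note carriers = is_pure_state_carrier[OF p]
  let ?q = "symmetrizer N \<tau> *\<^sub>v p"
  let ?F = "\<lambda>i. if i \<le> \<tau> i then (cmod (?q $ i))\<^sup>2 else 0"
  let ?G = "\<lambda>i. (cmod (p $ i + p $ \<tau> i))\<^sup>2"
  have row: "?q $ i = (if \<tau> i = i then p $ i
      else ((if i < \<tau> i then p $ i else - p $ i) + p $ \<tau> i) / sqrt 2)" if "i < N" for i
    using index_mult_mat_vec_sum[OF symmetrizer_carrier carriers that] sum_symmetrizer_row[OF that]
    by simp
  have orbit: "?F i + ?F (\<tau> i) = ?G i / 2" if i: "i < N" for i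
  proof -
    have "cmod (p $ i + p $ i) = 2 * cmod (p $ i)" by (simp flip: mult_2 add: norm_mult)
    then show ?thesis
      using i invol[OF i] range[OF i]
      by (cases i "\<tau> i" rule: linorder_cases)
        (simp_all add: row norm_divide power_divide power_mult_distrib add.commute)
  qed
  have "2 * (\<Sum>i<N. ?F i) = (\<Sum>i<N. ?F i) + (\<Sum>i<N. ?F (\<tau> i))"
    using sum_involution[of ?F] by simp
  also have "\<dots> = (\<Sum>i<N. ?G i / 2)"
    unfolding sum.distrib[symmetric] by (intro sum.cong refl orbit) auto
  also have "\<dots> = (\<Sum>i<N. ((cmod (p $ i))\<^sup>2 + (cmod (p $ \<tau> i))\<^sup>2 + 2 * Re (p $ i * cnj (p $ \<tau> i))) / 2)"
    unfolding cmod_power2 by (intro sum.cong refl) (simp add: power2_eq_square algebra_simps)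
  also have "\<dots> = ((\<Sum>i<N. (cmod (p $ i))\<^sup>2) + (\<Sum>i<N. (cmod (p $ \<tau> i))\<^sup>2)
      + 2 * Re (\<Sum>i<N. p $ i * cnj (p $ \<tau> i))) / 2"
    by (simp only: sum_divide_distrib[symmetric] sum.distrib sum_distrib_left[symmetric] Re_sum)
  also have "(\<Sum>i<N. (cmod (p $ \<tau> i))\<^sup>2) = (\<Sum>i<N. (cmod (p $ i))\<^sup>2)"
    by (rule sum_involution[where f = "\<lambda>i. (cmod (p $ i))\<^sup>2"])
  also have "(\<Sum>i<N. p $ i * cnj (p $ \<tau> i)) = p \<bullet>c (perm_mat N \<tau> *\<^sub>v p)"
    using range by (simp add: index_perm_mat_mult_vec[OF carriers]
        cscalar_prod_sum[OF carriers mult_mat_vec_carrier[OF perm_mat_carrier carriers]])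
  finally have "2 * (\<Sum>i<N. ?F i) = 1 + Re (p \<bullet>c (perm_mat N \<tau> *\<^sub>v p))"
    using p by (simp add: is_pure_state_def)
  then show ?thesis by (simp add: accept_prob_eq_sum)
qed

end

definition system_swap :: "nat \<Rightarrow> nat \<Rightarrow> nat \<Rightarrow> nat" where
  "system_swap a d i = (let n = a*d; x = i div n; y = i mod n in
     ((x div d)*d + y mod d)*n + ((y div d)*d + x mod d))"

lemma system_swap_index:
  assumes "k < a" "j < d" "k' < a" "j' < d"
  shows "system_swap a d ((k*d+j)*(a*d) + (k'*d+j')) = (k*d+j')*(a*d) + (k'*d+j)"
  using assms pair_index_less[of k' a j' d] by (simp add: system_swap_def Let_def)

lemma involution_system_swap: "involution ((a*d)*(a*d)) (system_swap a d)"
proof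
  fix i assume "i < (a*d)*(a*d)"
  then obtain x y where xy: "x < a*d" "y < a*d" "i = x*(a*d) + y" by (rule pair_index_cases)
  obtain k j where kj: "k < a" "j < d" "x = k*d+j" using xy(1) by (rule pair_index_cases)
  obtain k' j' where kj': "k' < a" "j' < d" "y = k'*d+j'" using xy(2) by (rule pair_index_cases)
  show "system_swap a d i < (a*d)*(a*d)" "system_swap a d (system_swap a d i) = i"
    using kj kj' xy(3) by (simp_all add: system_swap_index pair_index_less)
qed

lemma cscalar_prod_system_swap:
  assumes x: "x \<in> carrier_vec (a*d)" and y: "y \<in> carrier_vec (a*d)"
  shows "vkron x y \<bullet>c (perm_mat ((a*d)*(a*d)) (system_swap a d) *\<^sub>v vkron x y)
    = (\<Sum>j<d. \<Sum>j'<d. ptrace_A a d (outer x) $$ (j,j') * ptrace_A a d (outer y) $$ (j',j))"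
proof -
  let ?n = "a*d" and ?p = "vkron x y" and ?\<tau> = "system_swap a d"
  let ?\<rho> = "\<lambda>x j j' k. x $ (k*d+j) * cnj (x $ (k*d+j'))"
  interpret involution "?n * ?n" ?\<tau> by (rule involution_system_swap)
  have p: "?p \<in> carrier_vec (?n * ?n)" by (rule vkron_carrier[OF x y])
  have less: "k*d+j < ?n" if "k < a" "j < d" for k j using that by (rule pair_index_less)
  have ptrace: "ptrace_A a d (outer v) $$ (j,j') = (\<Sum>k<a. ?\<rho> v j j' k)"
    if "v \<in> carrier_vec ?n" "j < d" "j' < d" for v j j'
    using that less by (simp add: ptrace_A_def outer_def)
  have "?p \<bullet>c (perm_mat (?n * ?n) ?\<tau> *\<^sub>v ?p) = (\<Sum>i<?n * ?n. ?p $ i * cnj (?p $ ?\<tau> i))"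
    by (simp add: cscalar_prod_sum[OF p mult_mat_vec_carrier[OF perm_mat_carrier p]]
        index_perm_mat_mult_vec[OF p] range)
  also have "\<dots> = (\<Sum>k<a. \<Sum>j<d. \<Sum>k'<a. \<Sum>j'<d. ?\<rho> x j j' k * ?\<rho> y j' j k')"
    unfolding sum_mult_index[of _ ?n ?n] sum_mult_index[of _ a d]
  proof (intro sum.cong refl)
    fix k j k' j' assume "k \<in> {..<a}" "j \<in> {..<d}" "k' \<in> {..<a}" "j' \<in> {..<d}"
    then have kj: "k < a" "j < d" "k' < a" "j' < d" by auto
    show "?p $ ((k*d+j)*?n + (k'*d+j')) * cnj (?p $ ?\<tau> ((k*d+j)*?n + (k'*d+j')))
        = ?\<rho> x j j' k * ?\<rho> y j' j k'"
      unfolding system_swap_index[OF kj] index_vkron[OF x y less[OF kj(1,2)] less[OF kj(3,4)]]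
        index_vkron[OF x y less[OF kj(1,4)] less[OF kj(3,2)]]
      by simp
  qed
  also have "\<dots> = (\<Sum>j<d. \<Sum>k<a. \<Sum>j'<d. \<Sum>k'<a. ?\<rho> x j j' k * ?\<rho> y j' j k')"
    by (subst sum.swap, rule sum.cong[OF refl], rule sum.cong[OF refl], rule sum.swap)
  also have "\<dots> = (\<Sum>j<d. \<Sum>j'<d. \<Sum>k<a. \<Sum>k'<a. ?\<rho> x j j' k * ?\<rho> y j' j k')"
    by (rule sum.cong[OF refl], rule sum.swap)
  also have "\<dots> = (\<Sum>j<d. \<Sum>j'<d. ptrace_A a d (outer x) $$ (j,j') * ptrace_A a d (outer y) $$ (j',j))"
    unfolding sum_product[symmetric] by (intro sum.cong refl) (simp add: ptrace[OF x] ptrace[OF y])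
  finally show ?thesis .
qed

lemma conj_mat_mult_conjugate:
  assumes U: "U \<in> carrier_mat n m" and v: "v \<in> carrier_vec m"
  shows "conj_mat U *\<^sub>v conjugate v = conjugate (U *\<^sub>v v)"
proof (rule eq_vecI)
  fix k assume "k < dim_vec (conjugate (U *\<^sub>v v))"
  then have k: "k < n" using U by simp
  have "(conj_mat U *\<^sub>v conjugate v) $ k = (\<Sum>j<m. conj_mat U $$ (k,j) * conjugate v $ j)"
    using v by (intro index_mult_mat_vec_sum[OF conj_mat_carrier[OF U] _ k]) simp
  also have "\<dots> = cnj ((U *\<^sub>v v) $ k)"
    unfolding index_mult_mat_vec_sum[OF U v k] cnj_sum
    using U v k by (intro sum.cong refl) (simp add: conj_mat_def)
  finally show "(conj_mat U *\<^sub>v conjugate v) $ k = conjugate (U *\<^sub>v v) $ k" using U k by simp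
qed (use U in \<open>simp add: conj_mat_def\<close>)

lemma is_pure_state_conjugate:
  assumes "is_pure_state n v"
  shows "is_pure_state n (conjugate v)"
  using assms by (auto simp: is_pure_state_def)

lemma ptrace_A_conjugate:
  assumes "v \<in> carrier_vec (a*b)" "i < b" "j < b"
  shows "ptrace_A a b (outer (conjugate v)) $$ (i,j) = cnj (ptrace_A a b (outer v) $$ (i,j))"
  using assms pair_index_less[of _ a _ b] by (simp add: ptrace_A_def outer_def)

definition swap_test :: "nat \<Rightarrow> complex mat" where
  "swap_test d = symmetrizer ((2*d*d)*(2*d*d)) (system_swap (2*d) d)"

definition swap_test_accepts :: "nat \<Rightarrow> nat set" where
  "swap_test_accepts d = {i. i \<le> system_swap (2*d) d i}"

lemma is_unitary_swap_test: "is_unitary ((2*d*d)*(2*d*d)) (swap_test d)"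
  unfolding swap_test_def by (rule involution.is_unitary_symmetrizer[OF involution_system_swap])

lemma accept_prob_swap_test:
  assumes d_pos: "0 < d" and prep: "state_prep d \<psi> U" and \<psi>: "is_pure_state d \<psi>"
  defines "u \<equiv> U *\<^sub>v unit_vec (2*d*d) 0"
  shows "accept_prob ((2*d*d)*(2*d*d)) (swap_test_accepts d) (swap_test d *\<^sub>v vkron (conjugate u) u)
    = (1 + realness d \<psi>) / 2"
proof -
  let ?n = "2*d*d" and ?\<rho> = "ptrace_A (2*d) d (outer u)"
  have u: "is_pure_state ?n u" unfolding u_def
    using prep d_pos
    by (intro is_pure_state_unitary is_pure_state_unit_vec) (auto simp: state_prep_def)
  note carriers = is_pure_state_carrier[OF u]
    is_pure_state_carrier[OF is_pure_state_conjugate[OF u]]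
  have \<rho>: "?\<rho> $$ (i,j) = \<psi> $ i * cnj (\<psi> $ j)" if "i < d" "j < d" for i j
    using prep \<psi> that by (auto simp: state_prep_def u_def outer_def is_pure_state_def)
  have "vkron (conjugate u) u \<bullet>c (perm_mat (?n * ?n) (system_swap (2*d) d) *\<^sub>v vkron (conjugate u) u)
      = (\<Sum>j<d. \<Sum>j'<d. cnj ((\<psi> $ j)\<^sup>2) * (\<psi> $ j')\<^sup>2)"
    unfolding cscalar_prod_system_swap[OF carriers(2,1)]
    by (intro sum.cong refl)
      (simp add: ptrace_A_conjugate[OF carriers(1)] \<rho>, simp add: power2_eq_square)
  also have "\<dots> = cnj (\<Sum>j<d. (\<psi> $ j)\<^sup>2) * (\<Sum>j<d. (\<psi> $ j)\<^sup>2)"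
    by (simp add: sum_product)
  also have "\<dots> = realness d \<psi>"
    by (simp add: realness_def complex_norm_square mult.commute del: of_real_power)
  finally show ?thesis
    unfolding swap_test_def swap_test_accepts_def
    using involution.accept_prob_symmetrizer[OF involution_system_swap
        is_pure_state_vkron[OF is_pure_state_conjugate[OF u] u]] by simp
qed

lemma accept_prob_vkron:
  assumes p: "p \<in> carrier_vec n" and q: "q \<in> carrier_vec m"
  shows "accept_prob (n*m) {i. i div m \<in> A \<and> i mod m \<in> B} (vkron p q)
    = accept_prob n A p * accept_prob m B q"
  unfolding accept_prob_eq_sum sum_mult_index sum_product
  by (intro sum.cong refl) (auto simp: index_vkron[OF p q] norm_mult power_mult_distrib)

lemma query_op_mult_vkron:
  assumes U: "U \<in> carrier_mat n n" and x: "x \<in> carrier_vec n" and r: "r \<in> carrier_vec W"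
  shows "query_op QU U W *\<^sub>v vkron x r = vkron (U *\<^sub>v x) r"
    and "query_op QUconj U W *\<^sub>v vkron x r = vkron (conj_mat U *\<^sub>v x) r"
  using kron_mult_vkron[OF U one_carrier_mat x r]
    kron_mult_vkron[OF conj_mat_carrier[OF U] one_carrier_mat x r] r
  by (simp_all add: query_op_def)

lemma exchange_mat_rotates:
  assumes carriers: "w \<in> carrier_vec n" "x \<in> carrier_vec n" "y \<in> carrier_vec n" "z \<in> carrier_vec n"
  shows "exchange_mat n (n*(n*n)) *\<^sub>v vkron w (vkron x (vkron y z)) = vkron x (vkron y (vkron z w))"
proof -
  have "exchange_mat n (n*(n*n)) *\<^sub>v vkron w (vkron x (vkron y z)) = vkron (vkron x (vkron y z)) w"
    using carriers by (intro exchange_mat_mult_vkron vkron_carrier)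
  also have "\<dots> = vkron x (vkron (vkron y z) w)"
    by (rule vkron_assoc[OF carriers(2) vkron_carrier[OF carriers(3,4)] carriers(1)])
  also have "vkron (vkron y z) w = vkron y (vkron z w)" by (rule vkron_assoc[OF carriers(3,4,1)])
  finally show ?thesis .
qed

text \<open>The exchange rotates the four registers, so that the query always acts on the first one.\<close>

definition double_swap_test :: "nat \<Rightarrow> (query \<times> complex mat) list" where
  "double_swap_test d = (let n = 2*d*d; R = exchange_mat n (n*(n*n)) in
     [(QU, R), (QUconj, R), (QU, R), (QUconj, kron (swap_test d) (swap_test d))])"

definition double_swap_test_accepts :: "nat \<Rightarrow> nat set" where
  "double_swap_test_accepts d = (let M = (2*d*d)*(2*d*d) in
     {i. i div M \<in> swap_test_accepts d \<and> i mod M \<in> swap_test_accepts d})"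

lemma query_counts_double_swap_test:
  "length (filter (\<lambda>s. fst s = QU) (double_swap_test d)) = 2"
  "length (filter (\<lambda>s. fst s = QUconj) (double_swap_test d)) = 2"
  "length (double_swap_test d) = 4"
  by (simp_all add: double_swap_test_def Let_def)

lemma is_alg_double_swap_test:
  assumes d_pos: "0 < d"
  defines "n \<equiv> 2*d*d"
  shows "is_alg d (n*(n*n)) (1\<^sub>m (n*(n*(n*n)))) (double_swap_test d)"
proof -
  have "is_unitary (n*(n*(n*n))) (exchange_mat n (n*(n*n)))"
    by (rule is_unitary_exchange_mat)
  moreover have "is_unitary (n*(n*(n*n))) (kron (swap_test d) (swap_test d))"
    using is_unitary_kron[OF is_unitary_swap_test is_unitary_swap_test, of d d]
    by (simp add: n_def mult.assoc)
  ultimately show ?thesis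
    using d_pos by (auto simp: is_alg_def double_swap_test_def is_unitary_one n_def[symmetric] Let_def)
      (simp add: n_def)
qed

lemma final_state_double_swap_test:
  assumes d_pos: "0 < d" and U: "U \<in> carrier_mat (2*d*d) (2*d*d)"
  defines "n \<equiv> 2*d*d"
  defines "u \<equiv> U *\<^sub>v unit_vec n 0"
  defines "p \<equiv> swap_test d *\<^sub>v vkron (conjugate u) u"
  shows "final_state d (n*(n*n)) (1\<^sub>m (n*(n*(n*n)))) (double_swap_test d) U = vkron p p"
proof -
  define e where "e = (unit_vec n 0 :: complex vec)"
  have n: "0 < n" using d_pos by (simp add: n_def)
  have U: "U \<in> carrier_mat n n" using U by (simp add: n_def)
  have e: "e \<in> carrier_vec n" and u: "u \<in> carrier_vec n" "conjugate u \<in> carrier_vec n"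
    using U by (auto simp: e_def u_def)
  have "conjugate e = e" by (rule eq_vecI) (simp_all add: e_def unit_vec_def)
  then have Ue: "U *\<^sub>v e = u" "conj_mat U *\<^sub>v e = conjugate u"
    using conj_mat_mult_conjugate[OF U e] by (simp_all add: e_def u_def)
  have T: "swap_test d \<in> carrier_mat (n*n) (n*n)"
    using is_unitary_carrier[OF is_unitary_swap_test] by (simp add: n_def)
  have queries:
      "query_op QU U (n*(n*n)) *\<^sub>v vkron e (vkron x (vkron y z)) = vkron u (vkron x (vkron y z))"
      "query_op QUconj U (n*(n*n)) *\<^sub>v vkron e (vkron x (vkron y z))
        = vkron (conjugate u) (vkron x (vkron y z))"
    if "x \<in> carrier_vec n" "y \<in> carrier_vec n" "z \<in> carrier_vec n" for x y z
    using query_op_mult_vkron[OF U e] that by (simp_all add: vkron_carrier Ue)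
  have "unit_vec (n*(n*(n*n))) 0 = vkron e (vkron e (vkron e e))"
    using n by (simp add: e_def vkron_unit_vec)
  then have "final_state d (n*(n*n)) (1\<^sub>m (n*(n*(n*n)))) (double_swap_test d) U
      = kron (swap_test d) (swap_test d) *\<^sub>v vkron (conjugate u) (vkron u (vkron (conjugate u) u))"
    using e u by (simp add: final_state_def double_swap_test_def n_def[symmetric] Let_def
        queries exchange_mat_rotates vkron_carrier)
  also have "vkron (conjugate u) (vkron u (vkron (conjugate u) u))
      = vkron (vkron (conjugate u) u) (vkron (conjugate u) u)"
    by (rule vkron_assoc[symmetric, OF u(2,1) vkron_carrier[OF u(2,1)]])
  also have "kron (swap_test d) (swap_test d) *\<^sub>v \<dots> = vkron p p"
    unfolding p_def by (rule kron_mult_vkron[OF T T]) (intro vkron_carrier u)+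
  finally show ?thesis .
qed

lemma accept_prob_double_swap_test:
  assumes d_pos: "0 < d" and prep: "state_prep d \<psi> U" and \<psi>: "is_pure_state d \<psi>"
  defines "n \<equiv> 2*d*d"
  shows "accept_prob (n*(n*(n*n))) (double_swap_test_accepts d)
      (final_state d (n*(n*n)) (1\<^sub>m (n*(n*(n*n)))) (double_swap_test d) U)
    = ((1 + realness d \<psi>) / 2)\<^sup>2"
proof -
  let ?u = "U *\<^sub>v unit_vec n 0"
  let ?p = "swap_test d *\<^sub>v vkron (conjugate ?u) ?u"
  let ?A = "swap_test_accepts d"
  have U: "U \<in> carrier_mat n n" using prep by (simp add: state_prep_def is_unitary_def n_def)
  then have "vkron (conjugate ?u) ?u \<in> carrier_vec (n*n)" by (intro vkron_carrier) auto
  then have p: "?p \<in> carrier_vec (n*n)"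
    unfolding n_def by (rule mult_mat_vec_carrier[OF is_unitary_carrier[OF is_unitary_swap_test]])
  have "accept_prob (n*(n*(n*n))) (double_swap_test_accepts d)
        (final_state d (n*(n*n)) (1\<^sub>m (n*(n*(n*n)))) (double_swap_test d) U)
      = accept_prob ((n*n)*(n*n)) {i. i div (n*n) \<in> ?A \<and> i mod (n*n) \<in> ?A} (vkron ?p ?p)"
    unfolding final_state_double_swap_test[OF d_pos U[unfolded n_def], folded n_def]
      double_swap_test_accepts_def Let_def n_def[symmetric] by (simp only: mult.assoc)
  also have "\<dots> = (accept_prob (n*n) ?A ?p)\<^sup>2"
    by (simp only: accept_prob_vkron[OF p p] power2_eq_square)
  also have "accept_prob (n*n) ?A ?p = (1 + realness d \<psi>) / 2"
    unfolding n_def by (rule accept_prob_swap_test[OF d_pos prep \<psi>])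
  finally show ?thesis .
qed

lemma solves_reality_double_swap_test:
  assumes d_pos: "0 < d"
  defines "n \<equiv> 2*d*d"
  shows "solves_reality d {QU, QUconj} (n*(n*n)) (1\<^sub>m (n*(n*(n*n))))
    (double_swap_test d) (double_swap_test_accepts d)"
proof -
  have "((1 + realness d \<psi>) / 2)\<^sup>2 \<le> 1/3" if "realness d \<psi> < 1/10" for \<psi>
  proof -
    have "((1 + realness d \<psi>) / 2)\<^sup>2 \<le> (11/20)\<^sup>2"
      using that by (intro power_mono) (auto simp: realness_def)
    then show ?thesis by (simp add: power2_eq_square)
  qed
  moreover have "fst ` set (double_swap_test d) \<subseteq> {QU, QUconj}"
    by (simp add: double_swap_test_def Let_def)
  ultimately show ?thesis
    using is_alg_double_swap_test[OF d_pos] accept_prob_double_swap_test[OF d_pos]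
    unfolding solves_reality_def n_def by auto
qed

theorem theorem1p3:
  shows "(\<exists>c>0. \<forall>d::nat. d > 1000 \<longrightarrow>
            (\<forall>W V0 steps Acc. solves_reality d {QU, QUdag} W V0 steps Acc \<longrightarrow>
               real (length steps) \<ge> c * real d powr (1/4)))
       \<and> (\<forall>d::nat. d > 1000 \<longrightarrow>
            (\<exists>W V0 steps Acc. solves_reality d {QU, QUconj} W V0 steps Acc \<and>
               length (filter (\<lambda>s. fst s = QU) steps) = 2 \<and>
               length (filter (\<lambda>s. fst s = QUconj) steps) = 2 \<and>
               length steps = 4))"
proof (intro conjI exI[of _ "1/12"] allI impI)
  fix d W V0 steps Acc
  assume d: "d > 1000" and sol: "solves_reality d {QU, QUdag} W V0 steps Acc"
  have "1/12 * real d powr (1/4) \<le> 1/12 * real d powr (1/3)"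
    using d by (intro mult_left_mono powr_mono) auto
  also have "\<dots> \<le> length steps"
    using reality_query_lower_bound[OF _ sol] d by simp
  finally show "1/12 * real d powr (1/4) \<le> real (length steps)" .
next
  fix d :: nat
  assume "d > 1000"
  then have "solves_reality d {QU, QUconj} (2*d*d*(2*d*d*(2*d*d)))
      (1\<^sub>m (2*d*d*(2*d*d*(2*d*d*(2*d*d))))) (double_swap_test d) (double_swap_test_accepts d)"
    by (intro solves_reality_double_swap_test) simp
  then show "\<exists>W V0 steps Acc. solves_reality d {QU, QUconj} W V0 steps Acc \<and>
      length (filter (\<lambda>s. fst s = QU) steps) = 2 \<and>
      length (filter (\<lambda>s. fst s = QUconj) steps) = 2 \<and> length steps = 4"
    using query_counts_double_swap_test[of d] by blast
qed simp

end
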